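(* For each $n \ge 1$, let $f_n$ be the fraction, among all $(n+1)C_n^2$ cyclically marked tree pair diagrams of size $n$, of those diagrams whose associated element of Thompson's group $T$ has north-south dynamics as a map of the circle $S^1$. Then the limit $\lim_{n\to\infty} f_n$ exists and is positive.
   Context: Trees are finite rooted binary trees in which every internal node has an ordered left child and right child. A tree has size $n$ if it has $n$ internal nodes; it then has $n+1$ leaves, numbered $0,\dots,n$ from left to right, and the number of trees of size $n$ is the Catalan number $C_n=\frac{1}{n+1}\binom{2n}{n}$. A tree determines a subdivision of $[0,1)$ into half-open dyadic intervals, one per leaf: the root corresponds to $[0,1)$, and if a node corresponds to $[a,b)$ then its left and right children correspond to $[a,\frac{a+b}{2})$ and $[\frac{a+b}{2},b)$. Identify $S^1$ with $[0,1)$, i.e. with $\mathbb{R}/\mathbb{Z}$. Thompson's group $T$ is the group of orientation-preserving piecewise-linear homeomorphisms of $S^1=\mathbb{R}/\mathbb{Z}$ which map dyadic rationals to dyadic rationals, whose slopes, where defined, are powers of $2$, and whose breakpoints lie in the dyadic rationals $\mathbb{Z}[\frac12]$. A cyclically marked tree pair diagram of size $n$ is a triple $(S,R,i)$ where $S$ (source) and $R$ (target) are trees of size $n$ and $i\in\{0,\dots,n\}$ marks the leaf of $R$ to which leaf $0$ of $S$ is sent. The cyclic order determines the rest: leaf $j$ of $S$ is sent to leaf $(i+j) \bmod (n+1)$ of $R$. The associated element of $T$ maps the interval of each leaf of $S$ onto the interval of the corresponding leaf of $R$ by the increasing affine map. Diagrams are not required to be reduced; all diagrams are counted, so the same element of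 $T$ may be represented by many diagrams, of the same or different sizes. A map $g$ of the circle has north-south dynamics if it has exactly two fixed points, one of which is attracting for positive iterates of $g$ and the other of which is attracting for positive iterates of $g^{-1}$. (A fixed point $p$ is attracting for positive iterates of $h$ if $p$ has a neighborhood $U$ in $S^1$ such that $h^m(x)\to p$ as $m\to\infty$ for all $x\in U$.) *)

theory Defs
  imports "HOL-Analysis.Analysis" "HOL-Library.Tree"
begin

text \<open>
  The circle \<open>\<real>/\<int>\<close> has the fundamental domain \<open>[0,1)\<close> as its point set and
  carries the quotient topology along \<^const>\<open>frac\<close>, so that points close to \<open>0\<close>
  and points close to \<open>1\<close> are close to each other.
\<close>

definition circle :: "real set" where
  "circle = {0..<1}"

definition circle_top :: "real topology" where
  "circle_top = topology (\<lambda>U. U \<subseteq> circle \<and> open (frac -` U))"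

lemma openin_circle_top: "openin circle_top U \<longleftrightarrow> U \<subseteq> circle \<and> open (frac -` U :: real set)"
proof -
  have "istopology (\<lambda>U. U \<subseteq> circle \<and> open (frac -` U :: real set))"
    unfolding istopology_def by (auto simp: vimage_Union)
  then show ?thesis
    unfolding circle_top_def by simp
qed

lemma topspace_circle_top: "topspace circle_top = circle"
proof -
  have "frac -` circle = (UNIV :: real set)"
    by (auto simp: circle_def frac_lt_1)
  then have "openin circle_top circle"
    by (simp add: openin_circle_top)
  then show ?thesis
    by (metis openin_circle_top openin_subset openin_topspace subset_antisym)
qed

text \<open>
  Finite ordered rooted binary trees are the unlabelled trees \<^typ>\<open>unit tree\<close>, and
  \<open>size t\<close> is the number of internal nodes. \<open>leaf_intervals a b t\<close> lists the
  endpoints of the dyadic intervals of the leaves of \<open>t\<close> from left to right, where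
  the root corresponds to \<open>[a,b)\<close>.
\<close>

fun leaf_intervals :: "real \<Rightarrow> real \<Rightarrow> unit tree \<Rightarrow> (real \<times> real) list" where
  "leaf_intervals a b Leaf = [(a, b)]"
| "leaf_intervals a b (Node l _ r) =
     leaf_intervals a ((a + b) / 2) l @ leaf_intervals ((a + b) / 2) b r"

definition leaf_lo :: "unit tree \<Rightarrow> nat \<Rightarrow> real" where
  "leaf_lo t j = fst (leaf_intervals 0 1 t ! j)"

definition leaf_hi :: "unit tree \<Rightarrow> nat \<Rightarrow> real" where
  "leaf_hi t j = snd (leaf_intervals 0 1 t ! j)"

definition marked_diagrams :: "nat \<Rightarrow> (unit tree \<times> unit tree \<times> nat) set" where
  "marked_diagrams n = {(S, R, i). size S = n \<and> size R = n \<and> i \<le> n}"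

text \<open>
  The homeomorphism of the circle represented by a diagram. Only its values on \<^const>\<open>circle\<close>
  are meaningful.
\<close>

fun diagram_map :: "unit tree \<times> unit tree \<times> nat \<Rightarrow> real \<Rightarrow> real" where
  "diagram_map (S, R, i) x =
     (let j = (THE j. j \<le> size S \<and> x \<in> {leaf_lo S j..<leaf_hi S j});
          k = (i + j) mod (size S + 1)
      in leaf_lo R k +
         (x - leaf_lo S j) * ((leaf_hi R k - leaf_lo R k) / (leaf_hi S j - leaf_lo S j)))"

definition attracting :: "(real \<Rightarrow> real) \<Rightarrow> real \<Rightarrow> bool" where
  "attracting h p \<longleftrightarrow>
     (\<exists>U. openin circle_top U \<and> p \<in> U \<and>
          (\<forall>x\<in>U. limitin circle_top (\<lambda>m. (h ^^ m) x) p sequentially))"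

definition north_south :: "(real \<Rightarrow> real) \<Rightarrow> bool" where
  "north_south g \<longleftrightarrow>
     (\<exists>p q. p \<noteq> q \<and> {x \<in> circle. g x = x} = {p, q} \<and>
            attracting g p \<and> attracting (inv_into circle g) q)"

definition ns_fraction :: "nat \<Rightarrow> real" where
  "ns_fraction n =
     real (card {D \<in> marked_diagrams n. north_south (diagram_map D)}) /
     real (card (marked_diagrams n))"


section \<open>Well-definedness\<close>

lemma finite_unit_trees: "finite {t :: unit tree. size t = n}"
proof (induction n rule: less_induct)
  case (less n)
  have "{t :: unit tree. size t = n} \<subseteq>
      insert Leaf ((\<lambda>(l, r). Node l () r) `
        ((\<Union>m<n. {t. size t = m}) \<times> (\<Union>m<n. {t. size t = m})))"
  proof
    fix t :: "unit tree"
    assume "t \<in> {t. size t = n}"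
    then show "t \<in> insert Leaf ((\<lambda>(l, r). Node l () r) `
        ((\<Union>m<n. {t. size t = m}) \<times> (\<Union>m<n. {t. size t = m})))"
      by (cases t) (auto simp: image_iff)
  qed
  moreover have "finite (\<Union>m<n. {t :: unit tree. size t = m})"
    using less by auto
  ultimately show ?case
    by (meson finite.insertI finite_SigmaI finite_imageI finite_subset)
qed

lemma marked_diagrams_eq:
  "marked_diagrams n = {t. size t = n} \<times> {t. size t = n} \<times> {..n}"
  by (auto simp: marked_diagrams_def)

lemma finite_marked_diagrams: "finite (marked_diagrams n)"
  by (simp add: marked_diagrams_eq finite_unit_trees)

lemma card_marked_diagrams:
  "card (marked_diagrams n) = (n + 1) * (card {t :: unit tree. size t = n})\<^sup>2"
  by (simp add: marked_diagrams_eq card_cartesian_product power2_eq_square algebra_simps)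

lemma length_leaf_intervals: "length (leaf_intervals a b t) = size t + 1"
  by (induction t arbitrary: a b) auto

lemma leaf_intervals_partition:
  assumes "a < b"
  shows "(\<forall>(c, d) \<in> set (leaf_intervals a b t). a \<le> c \<and> c < d \<and> d \<le> b) \<and>
         (\<forall>x\<in>{a..<b}. \<exists>!j. j < length (leaf_intervals a b t) \<and>
            fst (leaf_intervals a b t ! j) \<le> x \<and> x < snd (leaf_intervals a b t ! j))"
  using assms
proof (induction t arbitrary: a b)
  case Leaf
  then show ?case by auto
next
  case (Node l u r)
  define m where "m = (a + b) / 2"
  have m: "a < m" "m < b"
    using Node.prems by (auto simp: m_def)
  define L where "L = leaf_intervals a m l"
  define R where "R = leaf_intervals m b r"
  note IL = Node.IH(1)[OF m(1), folded L_def]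
  note IR = Node.IH(2)[OF m(2), folded R_def]
  have eq: "leaf_intervals a b (Node l u r) = L @ R"
    by (simp add: L_def R_def m_def)
  have 1: "\<forall>(c, d) \<in> set (L @ R). a \<le> c \<and> c < d \<and> d \<le> b"
    using IL IR m by fastforce
  have L: "a \<le> fst (L ! j) \<and> snd (L ! j) \<le> m" if "j < length L" for j
    using IL nth_mem[OF that] by (simp add: case_prod_beta)
  have R: "m \<le> fst (R ! j) \<and> snd (R ! j) \<le> b" if "j < length R" for j
    using IR nth_mem[OF that] by (simp add: case_prod_beta)
  have 2: "\<exists>!j. j < length (L @ R) \<and> fst ((L @ R) ! j) \<le> x \<and> x < snd ((L @ R) ! j)"
    if x: "x \<in> {a..<b}" for x
  proof (cases "x < m")
    case True
    then have "\<exists>!j. j < length L \<and> fst (L ! j) \<le> x \<and> x < snd (L ! j)"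
      using IL x by auto
    then obtain j where j: "j < length L" "fst (L ! j) \<le> x" "x < snd (L ! j)"
      and u: "\<And>k. k < length L \<Longrightarrow> fst (L ! k) \<le> x \<Longrightarrow> x < snd (L ! k) \<Longrightarrow> k = j"
      by metis
    show ?thesis
    proof (rule ex1I[of _ j])
      show "j < length (L @ R) \<and> fst ((L @ R) ! j) \<le> x \<and> x < snd ((L @ R) ! j)"
        using j by (simp add: nth_append)
      fix k
      assume k: "k < length (L @ R) \<and> fst ((L @ R) ! k) \<le> x \<and> x < snd ((L @ R) ! k)"
      show "k = j"
      proof (cases "k < length L")
        case True
        then show ?thesis using k u by (simp add: nth_append)
      next
        case False
        then have "k - length L < length R" using k by auto
        then show ?thesis using k R[of "k - length L"] \<open>x < m\<close> False by (simp add: nth_append)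
      qed
    qed
  next
    case False
    then have "\<exists>!j. j < length R \<and> fst (R ! j) \<le> x \<and> x < snd (R ! j)"
      using IR x by auto
    then obtain j where j: "j < length R" "fst (R ! j) \<le> x" "x < snd (R ! j)"
      and u: "\<And>k. k < length R \<Longrightarrow> fst (R ! k) \<le> x \<Longrightarrow> x < snd (R ! k) \<Longrightarrow> k = j"
      by metis
    show ?thesis
    proof (rule ex1I[of _ "length L + j"])
      show "length L + j < length (L @ R) \<and> fst ((L @ R) ! (length L + j)) \<le> x \<and>
          x < snd ((L @ R) ! (length L + j))"
        using j by (simp add: nth_append)
      fix k
      assume k: "k < length (L @ R) \<and> fst ((L @ R) ! k) \<le> x \<and> x < snd ((L @ R) ! k)"
      show "k = length L + j"
      proof (cases "k < length L")
        case True
        then show ?thesis using k L[of k] \<open>\<not> x < m\<close> by (auto simp: nth_append)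
      next
        case False
        then have "k - length L < length R" using k by auto
        then show ?thesis using k u[of "k - length L"] False by (simp add: nth_append)
      qed
    qed
  qed
  show ?case
    unfolding eq using 1 2 by blast
qed

lemma leaf_bounds:
  assumes "j \<le> size t"
  shows "0 \<le> leaf_lo t j" "leaf_lo t j < leaf_hi t j" "leaf_hi t j \<le> 1"
proof -
  have "leaf_intervals 0 1 t ! j \<in> set (leaf_intervals 0 1 t)"
    using assms by (intro nth_mem) (simp add: length_leaf_intervals)
  then show "0 \<le> leaf_lo t j" "leaf_lo t j < leaf_hi t j" "leaf_hi t j \<le> 1"
    using leaf_intervals_partition[OF zero_less_one, THEN conjunct1, of t]
    by (auto simp: leaf_lo_def leaf_hi_def case_prod_beta)
qed

lemma leaf_unique:
  assumes "x \<in> circle"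
  shows "\<exists>!j. j \<le> size t \<and> x \<in> {leaf_lo t j..<leaf_hi t j}"
proof -
  have "j < size t + 1 \<longleftrightarrow> j \<le> size t" for j
    by auto
  then show ?thesis
    using bspec[OF leaf_intervals_partition[OF zero_less_one, THEN conjunct2, of t]
        assms[unfolded circle_def]]
    unfolding length_leaf_intervals leaf_lo_def leaf_hi_def atLeastLessThan_iff by (simp only:)
qed

lemma diagram_map_on_leaf:
  assumes "j \<le> size S" "x \<in> {leaf_lo S j..<leaf_hi S j}" "k = (i + j) mod (size S + 1)"
  shows "diagram_map (S, R, i) x =
    leaf_lo R k + (x - leaf_lo S j) * ((leaf_hi R k - leaf_lo R k) / (leaf_hi S j - leaf_lo S j))"
proof -
  have "x \<in> circle"
    using assms(2) leaf_bounds[OF assms(1)] by (auto simp: circle_def)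
  then have "(THE j. j \<le> size S \<and> x \<in> {leaf_lo S j..<leaf_hi S j}) = j"
    using leaf_unique[of x S] assms by (intro the1_equality) auto
  then show ?thesis
    using assms(3) by (simp only: diagram_map.simps Let_def)
qed

lemma affine_bij_betw:
  fixes a b c d :: real
  assumes "a < b" "c < d"
  shows "bij_betw (\<lambda>x. c + (x - a) * ((d - c) / (b - a))) {a..<b} {c..<d}"
proof (rule bij_betw_byWitness[where f' = "\<lambda>y. a + (y - c) * ((b - a) / (d - c))"])
  show "\<forall>x\<in>{a..<b}. a + (c + (x - a) * ((d - c) / (b - a)) - c) * ((b - a) / (d - c)) = x"
    using assms by simp
  show "\<forall>y\<in>{c..<d}. c + (a + (y - c) * ((b - a) / (d - c)) - a) * ((d - c) / (b - a)) = y"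
    using assms by simp
  have *: "v \<le> v + (x - u) * ((w - v) / (z - u)) \<and> v + (x - u) * ((w - v) / (z - u)) < w"
    if "u < z" "v < w" "u \<le> x" "x < z" for u v w x z :: real
  proof -
    have "(x - u) / (z - u) < 1" "0 \<le> (x - u) / (z - u)"
      using that by auto
    then have "(x - u) / (z - u) * (w - v) < 1 * (w - v)" "0 \<le> (x - u) / (z - u) * (w - v)"
      using that by (auto intro: mult_strict_right_mono mult_nonneg_nonneg simp del: times_divide_eq_left)
    then show ?thesis by simp
  qed
  show "(\<lambda>x. c + (x - a) * ((d - c) / (b - a))) ` {a..<b} \<subseteq> {c..<d}"
    using *[of a b c d] assms by auto
  show "(\<lambda>y. a + (y - c) * ((b - a) / (d - c))) ` {c..<d} \<subseteq> {a..<b}"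
    using *[of c d a b] assms by auto
qed

lemma diagram_map_leaf_bij:
  assumes "size R = size S" "j \<le> size S" "k = (i + j) mod (size S + 1)"
  shows "bij_betw (diagram_map (S, R, i)) {leaf_lo S j..<leaf_hi S j} {leaf_lo R k..<leaf_hi R k}"
proof -
  have "k \<le> size R"
    using assms by (simp add: less_Suc_eq_le[symmetric])
  then have "bij_betw
     (\<lambda>x. leaf_lo R k + (x - leaf_lo S j) * ((leaf_hi R k - leaf_lo R k) / (leaf_hi S j - leaf_lo S j)))
     {leaf_lo S j..<leaf_hi S j} {leaf_lo R k..<leaf_hi R k}"
    using assms(2) by (intro affine_bij_betw leaf_bounds)
  with diagram_map_on_leaf[OF assms(2) _ assms(3)] show ?thesis
    by (rule bij_betw_cong[THEN iffD2])
qed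

lemma bij_betw_diagram_map:
  assumes "(S, R, i) \<in> marked_diagrams n"
  shows "bij_betw (diagram_map (S, R, i)) circle circle"
proof -
  have n: "size S = n" "size R = n" "i \<le> n"
    using assms by (auto simp: marked_diagrams_def)
  define g where "g = diagram_map (S, R, i)"
  define I where "I t j = {leaf_lo t j..<leaf_hi t j}" for t j
  define s where "s j = (i + j) mod (n + 1)" for j
  have g: "bij_betw g (I S j) (I R (s j))" if "j \<le> n" for j
    using diagram_map_leaf_bij[of R S j "s j" i] that n by (simp add: g_def I_def s_def)
  have sn: "s j \<le> n" for j
    by (simp add: s_def less_Suc_eq_le[symmetric])
  have s_surj: "s ` {..n} = {..n}"
  proof
    show "{..n} \<subseteq> s ` {..n}"
    proof
      fix k
      assume "k \<in> {..n}"
      define j where "j = (k + (n + 1 - i)) mod (n + 1)"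
      have "s j = (i + (k + (n + 1 - i))) mod (n + 1)"
        unfolding s_def j_def by (rule mod_add_right_eq)
      also have "i + (k + (n + 1 - i)) = k + (n + 1)"
        using n(3) by simp
      also have "(k + (n + 1)) mod (n + 1) = k"
        using \<open>k \<in> {..n}\<close> by (simp only: mod_add_self2) simp
      finally have "s j = k" .
      moreover have "j \<in> {..n}"
        by (simp add: j_def less_Suc_eq_le[symmetric])
      ultimately show "k \<in> s ` {..n}" by blast
    qed
  qed (use sn in auto)
  then have s_inj: "inj_on s {..n}"
    by (intro finite_surj_inj) auto
  have cov: "\<exists>j\<le>n. x \<in> I t j" if "x \<in> circle" "size t = n" for x t
    using leaf_unique[OF that(1), of t] that(2) unfolding I_def by blast
  have sub: "I t j \<subseteq> circle" if "j \<le> n" "size t = n" for t j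
    using leaf_bounds[of j t] that by (auto simp: I_def circle_def)
  have uniq: "j = k" if "x \<in> I t j" "x \<in> I t k" "j \<le> n" "k \<le> n" "size t = n" for x t j k
  proof -
    have "x \<in> circle" using sub that by blast
    from leaf_unique[OF this, of t] show ?thesis
      using that unfolding I_def by blast
  qed
  have "inj_on g circle"
  proof (rule inj_onI)
    fix x y
    assume xy: "x \<in> circle" "y \<in> circle" "g x = g y"
    obtain j k where jk: "j \<le> n" "x \<in> I S j" "k \<le> n" "y \<in> I S k"
      using cov xy n by metis
    have "g x \<in> I R (s j)" "g y \<in> I R (s k)"
      using jk g bij_betwE by blast+
    then have "s j = s k"
      using uniq xy(3) sn n by metis
    then have "j = k"
      using s_inj jk by (auto simp: inj_on_def)
    then show "x = y"
      using g[OF jk(1)] jk xy(3) by (auto simp: bij_betw_def inj_on_def)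
  qed
  moreover have "g ` circle \<subseteq> circle"
  proof
    fix y
    assume "y \<in> g ` circle"
    then obtain x where x: "x \<in> circle" "y = g x" by auto
    then obtain j where "j \<le> n" "x \<in> I S j"
      using cov n by metis
    then show "y \<in> circle"
      using x g bij_betwE sub[OF sn n(2)] by blast
  qed
  moreover have "circle \<subseteq> g ` circle"
  proof
    fix y
    assume "y \<in> circle"
    then obtain k where k: "k \<le> n" "y \<in> I R k"
      using cov n by metis
    then obtain j where j: "j \<le> n" "k = s j"
      using s_surj by blast
    then have "y \<in> g ` I S j"
      using g[OF j(1)] k by (auto simp: bij_betw_def)
    then show "y \<in> g ` circle"
      using sub[OF j(1) n(1)] by blast
  qed
  ultimately show ?thesis
    by (auto simp: bij_betw_def g_def)
qed

end

(*
  The limit is 1. A uniform random tree has, at each fixed depth, a node below which all but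
  boundedly many internal nodes lie, and by symmetry the address of that node is uniformly
  distributed. Let w and v be such nodes of S and R at a large depth. Their addresses separate
  early, so v lies below one of the small subtrees of S hanging off the path to w; hence, if the
  depth is large enough, v lies strictly inside a leaf of S, and likewise w lies strictly inside
  a leaf of R. For most marks i the map sends the complement of the interval of w into the
  interval of v, which forces north-south dynamics.
*)
theory Submission
  imports Defs "HOL-Library.Sublist" "HOL-Computational_Algebra.Formal_Power_Series"
begin

section \<open>Nodes and their addresses\<close>

text \<open>The bounded loss depends on the depth, so one depth cannot serve both to separate the
  addresses and to push each node below a leaf of the other tree. Two depths are used. At depth
  \<open>D\<close> the large nodes of \<open>S\<close> and \<open>R\<close> have different addresses
  except with probability about \<open>1 / 2 ^ D\<close>, and at most \<open>K'\<close> nodes are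
  lost there; the side subtrees met on deviating are therefore at most \<open>K'\<close> deep. Only
  then is the second depth \<open>D + K' + D\<close> fixed, with its own, possibly far larger, loss
  \<open>K\<close>, which merely restricts the mark \<open>i\<close>.

  The last \<open>D\<close> letters serve strictness. A node below a leaf may share an endpoint with
  it, and a fixed point there need not attract from both sides. A right and a left turn below the
  leaf exclude this, and among \<open>D\<close> letters one of the two is missing only with
  probability of order \<open>1 / 2 ^ D\<close>.

  Leaves rather than arbitrary intervals are used because the map is affine on a leaf of
  \<open>S\<close> and its inverse is affine on a leaf of \<open>R\<close>: strict inclusion then
  gives a unique attracting fixed point by explicit computation.\<close>

fun subtree_at :: "bool list \<Rightarrow> 'a tree \<Rightarrow> 'a tree option" where
  "subtree_at [] t = Some t"
| "subtree_at (c # u) Leaf = None"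
| "subtree_at (c # u) (Node l x r) = subtree_at u (if c then r else l)"

lemma subtree_at_Leaf: "subtree_at u Leaf = (if u = [] then Some Leaf else None)"
  by (cases u) auto

fun node_ivl :: "real \<Rightarrow> real \<Rightarrow> bool list \<Rightarrow> real \<times> real" where
  "node_ivl a b [] = (a, b)"
| "node_ivl a b (c # u) = (if c then node_ivl ((a + b) / 2) b u else node_ivl a ((a + b) / 2) u)"

lemma size_subtree_at: "subtree_at u t = Some s \<Longrightarrow> size s \<le> size t"
  by (induction u t rule: subtree_at.induct) (auto split: if_splits)

lemma subtree_at_append:
  "subtree_at (u @ v) t = Some s \<Longrightarrow> \<exists>s'. subtree_at u t = Some s' \<and> size s \<le> size s'"
  by (induction u t rule: subtree_at.induct) (auto dest: size_subtree_at split: if_splits)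

lemma subtree_at_extend_leaf:
  "subtree_at u t = Some Leaf \<Longrightarrow> subtree_at (u @ v) t = Some s \<Longrightarrow> s = Leaf"
proof (induction u t rule: subtree_at.induct)
  case (1 t)
  then show ?case by (cases v) auto
qed auto

lemma subtree_at_disjoint:
  assumes "subtree_at u t = Some s" "subtree_at v t = Some s'" "length u = length v" "u \<noteq> v"
  shows "size s + size s' < size t"
  using assms
proof (induction u t arbitrary: v rule: subtree_at.induct)
  case (3 c u l x r)
  then obtain c' v' where v: "v = c' # v'" by (cases v) auto
  show ?case
  proof (cases "c = c'")
    case True
    then show ?thesis using 3 v by (fastforce split: if_splits)
  next
    case False
    then show ?thesis
      using 3 v size_subtree_at[of u _ s] size_subtree_at[of v' _ s'] by (fastforce split: if_splits)
  qed
qed auto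

text \<open>Every step down leaves an internal node behind, so a path cannot make more than
  \<open>size t\<close> steps before it stands on a leaf.\<close>

lemma path_meets_leaf:
  assumes "size t \<le> length v"
  shows "\<exists>x y. v = x @ y \<and> length x \<le> size t \<and> subtree_at x t = Some Leaf"
  using assms
proof (induction t arbitrary: v)
  case Leaf
  show ?case by (rule exI[of _ "[]"]) auto
next
  case (Node l a r)
  then obtain c v' where v: "v = c # v'" by (cases v) auto
  have "\<exists>x y. v' = x @ y \<and> length x \<le> size (if c then r else l) \<and>
      subtree_at x (if c then r else l) = Some Leaf"
    using Node v by auto
  then obtain x y where "v' = x @ y" "length x \<le> size (if c then r else l)"
    "subtree_at x (if c then r else l) = Some Leaf" by blast
  then show ?case
    using v by (intro exI[of _ "c # x"] exI[of _ y]) (auto split: if_splits)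
qed

text \<open>Where \<open>v\<close> first deviates from \<open>u\<close> it enters a subtree disjoint
  from \<open>s\<close>. That subtree has at most \<open>K\<close> internal nodes, so
  \<open>path_meets_leaf\<close> bounds the remaining steps by \<open>K\<close>.\<close>

lemma leaving_path_meets_leaf:
  assumes "subtree_at u t = Some s" "size t \<le> size s + K" "length u + K \<le> length v"
    "take (length u) v \<noteq> u"
  shows "\<exists>x y. v = x @ y \<and> length x \<le> length u + K \<and> subtree_at x t = Some Leaf"
  using assms
proof (induction u t arbitrary: v rule: subtree_at.induct)
  case (3 c u l a r)
  then obtain c' v' where v: "v = c' # v'" by (cases v) auto
  have "\<exists>x y. v' = x @ y \<and> length x \<le> length u + K \<and> subtree_at x (if c' then r else l) = Some Leaf"
  proof (cases "c = c'")
    case True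
    then show ?thesis
      using 3 v by (auto split: if_splits)
  next
    case False
    have "size s \<le> size (if c then r else l)"
      using 3 size_subtree_at by auto
    with False 3(3) have "size (if c' then r else l) \<le> K"
      by (auto split: if_splits)
    then show ?thesis
      using path_meets_leaf[of "if c' then r else l" v'] 3(4) v by fastforce
  qed
  then obtain x y where "v' = x @ y" "length x \<le> length u + K"
    "subtree_at x (if c' then r else l) = Some Leaf" by blast
  then show ?case
    using v by (intro exI[of _ "c' # x"] exI[of _ y]) (auto split: if_splits)
qed auto

section \<open>Dyadic intervals of nodes and of leaves\<close>

lemma node_ivl_bounds:
  assumes "a < b"
  shows "a \<le> fst (node_ivl a b u) \<and> fst (node_ivl a b u) < snd (node_ivl a b u) \<and>
    snd (node_ivl a b u) \<le> b \<and>
    (True \<in> set u \<longrightarrow> a < fst (node_ivl a b u)) \<and> (False \<in> set u \<longrightarrow> snd (node_ivl a b u) < b)"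
  using assms
proof (induction u arbitrary: a b)
  case (Cons c u)
  show ?case
    using Cons.IH[of "(a + b) / 2" b] Cons.IH[of a "(a + b) / 2"] Cons.prems by (cases c) auto
qed auto

lemma node_ivl_append:
  "node_ivl a b (u @ v) = node_ivl (fst (node_ivl a b u)) (snd (node_ivl a b u)) v"
  by (induction u arbitrary: a b) auto

text \<open>Dyadic intervals are nested or disjoint: the midpoint at the first differing letter
  separates the intervals of incomparable addresses.\<close>

lemma node_ivl_comparable:
  assumes "a < b" "x \<in> {fst (node_ivl a b u)..<snd (node_ivl a b u)}"
    "x \<in> {fst (node_ivl a b v)..<snd (node_ivl a b v)}"
  shows "prefix u v \<or> prefix v u"
  using assms
proof (induction u arbitrary: a b v)
  case (Cons c u)
  show ?case
  proof (cases v)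
    case (Cons c' v')
    have m: "a < (a + b) / 2" "(a + b) / 2 < b"
      using Cons.prems(1) by auto
    show ?thesis
      using Cons.IH[OF m(1), of v'] Cons.IH[OF m(2), of v'] Cons.prems Cons
        node_ivl_bounds[OF m(1), of u] node_ivl_bounds[OF m(2), of u]
        node_ivl_bounds[OF m(1), of v'] node_ivl_bounds[OF m(2), of v']
      by (auto split: if_splits)
  qed auto
qed auto

lemma leaf_intervals_subtree_at:
  assumes "subtree_at u t = Some s"
  shows "\<exists>xs ys. leaf_intervals a b t =
    xs @ leaf_intervals (fst (node_ivl a b u)) (snd (node_ivl a b u)) s @ ys"
  using assms
proof (induction u t arbitrary: a b rule: subtree_at.induct)
  case (1 t)
  then show ?case by (intro exI[of _ "[]"]) auto
next
  case (3 c u l y r)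
  show ?case
  proof (cases c)
    case True
    then obtain xs ys where "leaf_intervals ((a + b) / 2) b r =
        xs @ leaf_intervals (fst (node_ivl a b (c # u))) (snd (node_ivl a b (c # u))) s @ ys"
      using 3(1)[of "(a + b) / 2" b] 3(2) by auto
    then show ?thesis
      by (intro exI[of _ "leaf_intervals a ((a + b) / 2) l @ xs"] exI[of _ ys]) simp
  next
    case False
    then obtain xs ys where "leaf_intervals a ((a + b) / 2) l =
        xs @ leaf_intervals (fst (node_ivl a b (c # u))) (snd (node_ivl a b (c # u))) s @ ys"
      using 3(1)[of a "(a + b) / 2"] 3(2) by auto
    then show ?thesis
      by (intro exI[of _ xs] exI[of _ "ys @ leaf_intervals ((a + b) / 2) b r"]) simp
  qed
qed auto

lemma leaf_index:
  assumes "subtree_at u t = Some Leaf"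
  shows "\<exists>j\<le>size t. leaf_lo t j = fst (node_ivl 0 1 u) \<and> leaf_hi t j = snd (node_ivl 0 1 u)"
proof -
  obtain xs ys where eq: "leaf_intervals 0 1 t = xs @ node_ivl 0 1 u # ys"
    using leaf_intervals_subtree_at[OF assms, of 0 1] by auto
  then have "length xs \<le> size t"
    using length_leaf_intervals[of 0 1 t] by simp
  then show ?thesis
    using eq by (auto simp: leaf_lo_def leaf_hi_def)
qed

text \<open>The leaves below \<open>u\<close> form a contiguous block of \<open>size s + 1\<close>
  among \<open>size t + 1\<close> leaves. At most \<open>K\<close> leaves lie outside it, hence at
  most \<open>K\<close> at either end.\<close>

lemma central_leaf_in_node:
  assumes "subtree_at u t = Some s" "size t \<le> size s + K" "K \<le> j" "j + K \<le> size t"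
  shows "fst (node_ivl 0 1 u) \<le> leaf_lo t j" "leaf_hi t j \<le> snd (node_ivl 0 1 u)"
proof -
  define c where "c = fst (node_ivl 0 1 u)"
  define d where "d = snd (node_ivl 0 1 u)"
  obtain xs ys where eq: "leaf_intervals 0 1 t = xs @ leaf_intervals c d s @ ys"
    using leaf_intervals_subtree_at[OF assms(1), of 0 1] unfolding c_def d_def by blast
  have len: "size t = length xs + size s + length ys"
    using arg_cong[OF eq, of length] by (simp add: length_leaf_intervals)
  then have j: "length xs \<le> j" "j - length xs < length (leaf_intervals c d s)"
    using assms by (auto simp: length_leaf_intervals)
  have "c < d"
    using node_ivl_bounds[of 0 1 u] by (simp add: c_def d_def)
  have "leaf_intervals 0 1 t ! j = leaf_intervals c d s ! (j - length xs)"
    using j by (simp add: eq nth_append)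
  then have "leaf_intervals 0 1 t ! j \<in> set (leaf_intervals c d s)"
    using j by simp
  then have "c \<le> leaf_lo t j \<and> leaf_hi t j \<le> d"
    using leaf_intervals_partition[OF \<open>c < d\<close>, THEN conjunct1, of s]
    by (auto simp: leaf_lo_def leaf_hi_def case_prod_beta)
  then show "fst (node_ivl 0 1 u) \<le> leaf_lo t j" "leaf_hi t j \<le> snd (node_ivl 0 1 u)"
    by (auto simp: c_def d_def)
qed


section \<open>Dynamics\<close>

lemma openin_circle_top_interval:
  assumes "0 \<le> a" "b \<le> 1"
  shows "openin circle_top {a<..<b}"
proof -
  have "frac -` {a<..<b} = (\<Union>k::int. {a + of_int k<..<b + of_int k})"
  proof (intro set_eqI iffI)
    fix x assume "x \<in> frac -` {a<..<b}"
    then have "x \<in> {a + of_int \<lfloor>x\<rfloor><..<b + of_int \<lfloor>x\<rfloor>}"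
      by (auto simp: frac_def)
    then show "x \<in> (\<Union>k::int. {a + of_int k<..<b + of_int k})" by blast
  next
    fix x assume "x \<in> (\<Union>k::int. {a + of_int k<..<b + of_int k})"
    then obtain k :: int where k: "a + of_int k < x" "x < b + of_int k" by auto
    then have "\<lfloor>x\<rfloor> = k"
      using assms by (intro floor_unique) auto
    with k show "x \<in> frac -` {a<..<b}"
      by (auto simp: frac_def)
  qed
  moreover have "open (\<Union>k::int. {a + of_int k<..<b + of_int k})"
    by (intro open_UN) auto
  ultimately show ?thesis
    using assms by (auto simp: openin_circle_top circle_def)
qed

text \<open>On representatives, a circle neighbourhood is the trace of an open set of reals. The
  converse fails at \<open>0\<close>, whose neighbourhoods on the circle also contain points close
  to \<open>1\<close>.\<close>

lemma limitin_circle_top: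
  assumes "X \<longlonglongrightarrow> p" "p \<in> circle" "\<And>m. X m \<in> circle"
  shows "limitin circle_top X p sequentially"
  unfolding limitin_def
proof (intro conjI allI impI)
  show "p \<in> topspace circle_top"
    using assms by (simp add: topspace_circle_top)
  fix U assume U: "openin circle_top U \<and> p \<in> U"
  have fr: "frac x = x" if "x \<in> circle" for x
    using that by (simp add: circle_def frac_eq)
  have "open (frac -` U)" "p \<in> frac -` U"
    using U fr[OF assms(2)] by (auto simp: openin_circle_top)
  then have "\<forall>\<^sub>F m in sequentially. X m \<in> frac -` U"
    using assms(1) topological_tendstoD by blast
  then show "\<forall>\<^sub>F m in sequentially. X m \<in> U"
    by (rule eventually_mono) (use fr assms(3) in auto)
qed

text \<open>Strictness at both ends puts the fixed point inside \<open>{a<..<b}\<close>, an interval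
  that does not wrap around \<open>0\<close> and serves as the basin. Nothing is assumed about
  \<open>h\<close> outside \<open>{a..<b}\<close>, since iterates of points of the basin stay
  there.\<close>

lemma affine_contraction_attracting:
  fixes a b c d :: real
  assumes ab: "0 \<le> a" "b \<le> 1" and cd: "a < c" "c < d" "d < b"
    and h: "\<And>x. x \<in> {a..<b} \<Longrightarrow> h x = c + (x - a) * ((d - c) / (b - a))"
  shows "\<exists>p\<in>{c..<d}. attracting h p \<and> (\<forall>x\<in>{a..<b}. h x = x \<longleftrightarrow> x = p)"
proof -
  define l where "l = (d - c) / (b - a)"
  have l: "0 < l" "l < 1"
    using cd by (auto simp: l_def)
  \<comment> \<open>The solution of \<open>x = c + (x - a) * l\<close>: on \<open>{a..<b}\<close>
    the map is the homothety with centre \<open>p\<close> and ratio \<open>l < 1\<close>.\<close>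
  define p where "p = (c - a * l) / (1 - l)"
  have pl: "c = p * (1 - l) + a * l"
    using l by (simp add: p_def)
  have d_eq: "d = c + (b - a) * l"
    using cd by (simp add: l_def)
  have hp: "h x = p + l * (x - p)" if "x \<in> {a..<b}" for x
  proof -
    have "h x = c + (x - a) * l"
      unfolding l_def by (rule h[OF that])
    then show ?thesis using pl by (simp add: algebra_simps)
  qed
  have "(p - a) * (1 - l) = c - a" "(b - p) * (1 - l) = b - d"
    using pl d_eq by (auto simp: algebra_simps)
  then have "(p - a) * (1 - l) > 0" "(b - p) * (1 - l) > 0"
    using cd by auto
  then have p: "a < p" "p < b"
    using l by (auto simp: zero_less_mult_iff)
  have "p - c = l * (p - a)" "d - p = l * (b - p)"
    using pl d_eq by (auto simp: algebra_simps)
  then have pcd: "p \<in> {c..<d}"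
    using p l by (smt (verit) atLeastLessThan_iff mult_pos_pos)
  have iter: "(h ^^ m) x = p + l ^ m * (x - p) \<and> (h ^^ m) x \<in> {a<..<b}" if x: "x \<in> {a<..<b}" for m x
  proof (induction m)
    case (Suc m)
    define y where "y = (h ^^ m) x"
    have y: "y = p + l ^ m * (x - p)" "y \<in> {a<..<b}"
      using Suc by (auto simp: y_def)
    have hy: "h y = p + l * (y - p)"
      using hp y by auto
    have 1: "h y = p + l ^ Suc m * (x - p)"
      unfolding hy using y by simp
    have "h y = (1 - l) * p + l * y"
      using hy by (simp add: algebra_simps)
    moreover have "(1 - l) * p + l * y > (1 - l) * a + l * a" "(1 - l) * p + l * y < (1 - l) * b + l * b"
      using l p y by (auto intro!: add_strict_mono)
    ultimately have "h y \<in> {a<..<b}"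
      by (simp add: algebra_simps)
    then show ?case using 1 by (simp add: y_def)
  qed (use x in auto)
  have "attracting h p"
    unfolding attracting_def
  proof (intro exI conjI ballI)
    show "openin circle_top {a<..<b}" "p \<in> {a<..<b}"
      using ab p by (auto simp: openin_circle_top_interval)
    fix x assume x: "x \<in> {a<..<b}"
    show "limitin circle_top (\<lambda>m. (h ^^ m) x) p sequentially"
    proof (rule limitin_circle_top)
      have "(\<lambda>m. p + l ^ m * (x - p)) \<longlonglongrightarrow> p + 0 * (x - p)"
        using l by (intro tendsto_intros LIMSEQ_power_zero) auto
      then show "(\<lambda>m. (h ^^ m) x) \<longlonglongrightarrow> p"
        using iter[OF x] by simp
      show "p \<in> circle" using p ab by (auto simp: circle_def)
      show "(h ^^ m) x \<in> circle" for m
        using iter[OF x, of m] ab by (auto simp: circle_def)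
    qed
  qed
  moreover have "h x = x \<longleftrightarrow> x = p" if "x \<in> {a..<b}" for x
  proof -
    have "h x = x \<longleftrightarrow> (1 - l) * (x - p) = 0"
      using hp[OF that] by (auto simp: algebra_simps)
    then show ?thesis using l by auto
  qed
  ultimately show ?thesis using pcd by blast
qed

text \<open>
  The map sends the complement of the interval of the node \<open>w\<close> into the interval of the node
  \<open>v\<close>. Hence the leaf of \<open>S\<close> above \<open>v\<close> is contracted into itself, and
  the leaf of \<open>R\<close> above \<open>w\<close> is contracted into itself by the inverse.
\<close>

lemma north_south_diagram:
  assumes S: "size S = n" "subtree_at w S = Some s" "n \<le> size s + K"
    and R: "size R = n" "subtree_at v R = Some r" "n \<le> size r + K"
    and vw: "length v = length w" "v \<noteq> w"
    and v: "v = v0 @ v1" "subtree_at v0 S = Some Leaf" "True \<in> set v1" "False \<in> set v1"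
    and w: "w = w0 @ w1" "subtree_at w0 R = Some Leaf" "True \<in> set w1" "False \<in> set w1"
    and i: "2 * K \<le> i" "i + 2 * K \<le> n" and K: "K < n"
  shows "north_south (diagram_map (S, R, i))"
proof -
  define g where "g = diagram_map (S, R, i)"
  define lo where "lo u = fst (node_ivl 0 1 u)" for u
  define hi where "hi u = snd (node_ivl 0 1 u)" for u
  define I where "I u = {lo u..<hi u}" for u
  have bnd: "0 \<le> lo u" "lo u < hi u" "hi u \<le> 1" for u
    using node_ivl_bounds[of 0 1 u] by (auto simp: lo_def hi_def)
  have comp: "prefix u u' \<or> prefix u' u" if "x \<in> I u" "x \<in> I u'" for x u u'
    using node_ivl_comparable[of 0 1 x u u'] that by (simp add: I_def lo_def hi_def)
  have bij: "bij_betw g circle circle"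
    unfolding g_def by (rule bij_betw_diagram_map[of _ _ _ n]) (use S R i in \<open>simp add: marked_diagrams_def\<close>)
  \<comment> \<open>A right turn raises the left end and a left turn lowers the right end, so both
    kinds of turn are needed for strict inclusion.\<close>
  have strict: "lo u < lo (u @ z)" "hi (u @ z) < hi u" if "True \<in> set z" "False \<in> set z" for u z
    using node_ivl_bounds[OF bnd(2)[of u], of z] that
    by (auto simp: lo_def hi_def node_ivl_append)
  have disj_vw: "I v \<inter> I w = {}"
  proof (rule ccontr)
    assume "I v \<inter> I w \<noteq> {}"
    then have "prefix v w \<or> prefix w v" using comp by blast
    then show False using vw by (auto simp: prefix_def)
  qed
  have "s \<noteq> Leaf" "r \<noteq> Leaf"
    using S R K by auto
  \<comment> \<open>\<open>v0\<close> ends at a leaf of \<open>S\<close>, so the internal node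
    \<open>w\<close> is not below it; and \<open>w\<close> above \<open>v0\<close> would be above
    \<open>v\<close>, which has the same length as \<open>w\<close> and differs from it.\<close>
  have disj1: "I v0 \<inter> I w = {}"
  proof (rule ccontr)
    assume "I v0 \<inter> I w \<noteq> {}"
    then have "prefix v0 w \<or> prefix w v0" using comp by blast
    then show False
    proof
      assume "prefix v0 w"
      then show False
        using subtree_at_extend_leaf[OF v(2)] S \<open>s \<noteq> Leaf\<close> by (auto simp: prefix_def)
    qed (use v vw in \<open>auto simp: prefix_def\<close>)
  qed
  have disj2: "I w0 \<inter> I v = {}"
  proof (rule ccontr)
    assume "I w0 \<inter> I v \<noteq> {}"
    then have "prefix w0 v \<or> prefix v w0" using comp by blast
    then show False
    proof
      assume "prefix w0 v"
      then show False
        using subtree_at_extend_leaf[OF w(2)] R \<open>r \<noteq> Leaf\<close> by (auto simp: prefix_def)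
    qed (use w vw in \<open>auto simp: prefix_def\<close>)
  qed
  define k where "k j = (i + j) mod (n + 1)" for j
  have kn: "k j \<le> n" for j
    by (simp add: k_def less_Suc_eq_le[symmetric])
  have g_leaf: "g x = leaf_lo R (k j) +
      (x - leaf_lo S j) * ((leaf_hi R (k j) - leaf_lo R (k j)) / (leaf_hi S j - leaf_lo S j))"
    if "j \<le> n" "x \<in> {leaf_lo S j..<leaf_hi S j}" for j x
    using diagram_map_on_leaf[of j S x "k j" i R] that S by (simp add: g_def k_def)
  have g_bij: "bij_betw g {leaf_lo S j..<leaf_hi S j} {leaf_lo R (k j)..<leaf_hi R (k j)}"
    if "j \<le> n" for j
    using diagram_map_leaf_bij[of R S j "k j" i] that S R by (simp add: g_def k_def)
  \<comment> \<open>A leaf of \<open>S\<close> outside \<open>w\<close> is among the outermost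
    \<open>K\<close> at one end. Around the circle these form one run through leaf \<open>0\<close>,
    and the shift by \<open>i\<close> must land it in the central range from \<open>K\<close> to
    \<open>n - K\<close> of \<open>R\<close>. Room for the run on both sides of \<open>i\<close>
    plus the margin \<open>K\<close> gives the bounds \<open>2 * K\<close>.\<close>
  have out: "lo v \<le> leaf_lo R (k j)" "leaf_hi R (k j) \<le> hi v"
    if "j \<le> n" "x \<in> {leaf_lo S j..<leaf_hi S j}" "x \<notin> I w" for j x
  proof -
    have "j < K \<or> j + K > n"
      using central_leaf_in_node[OF S(2), of K j] that S by (force simp: I_def lo_def hi_def)
    then have "K \<le> k j \<and> k j + K \<le> n"
    proof
      assume "j < K"
      then have "k j = i + j" using i by (simp add: k_def)
      then show ?thesis using i \<open>j < K\<close> by simp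
    next
      assume "j + K > n"
      then have "i + j = (n + 1) + (i + j - (n + 1))" "i + j - (n + 1) < n + 1"
        using i that by auto
      then have "k j = i + j - (n + 1)"
        unfolding k_def by (metis mod_add_self1 mod_less)
      then show ?thesis using i \<open>j + K > n\<close> that(1) by linarith
    qed
    then show "lo v \<le> leaf_lo R (k j)" "leaf_hi R (k j) \<le> hi v"
      using central_leaf_in_node[OF R(2), of K "k j"] R by (auto simp: lo_def hi_def)
  qed
  have out': "g x \<in> I v" if x: "x \<in> circle" "x \<notin> I w" for x
  proof -
    obtain j where j: "j \<le> n" "x \<in> {leaf_lo S j..<leaf_hi S j}"
      using leaf_unique[OF x(1), of S] S by blast
    then have "g x \<in> {leaf_lo R (k j)..<leaf_hi R (k j)}"
      using g_bij bij_betwE by blast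
    then show ?thesis using out[OF j x(2)] by (auto simp: I_def)
  qed
  \<comment> \<open>Leaf \<open>j0\<close> of \<open>S\<close>, at \<open>v0\<close>, is disjoint
    from \<open>w\<close>; its image is a leaf of \<open>R\<close> inside \<open>v\<close>, hence
    strictly inside the leaf \<open>j0\<close> itself.\<close>
  obtain j0 where j0: "j0 \<le> n" "leaf_lo S j0 = lo v0" "leaf_hi S j0 = hi v0"
    using leaf_index[OF v(2)] S by (auto simp: lo_def hi_def)
  have "lo v0 \<in> I v0" using bnd by (simp add: I_def)
  then have k0: "lo v \<le> leaf_lo R (k j0)" "leaf_hi R (k j0) \<le> hi v"
    using out[OF j0(1), of "lo v0"] j0 disj1 by (auto simp: I_def)
  have "\<exists>p\<in>{leaf_lo R (k j0)..<leaf_hi R (k j0)}. attracting g p \<and> (\<forall>x\<in>{lo v0..<hi v0}. g x = x \<longleftrightarrow> x = p)"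
  proof (rule affine_contraction_attracting[OF bnd(1) bnd(3)])
    show "lo v0 < leaf_lo R (k j0)" "leaf_hi R (k j0) < hi v0"
      using k0 strict[OF v(3,4), of v0] v by auto
    show "leaf_lo R (k j0) < leaf_hi R (k j0)"
      using leaf_bounds kn R by auto
    show "g x = leaf_lo R (k j0) +
      (x - lo v0) * ((leaf_hi R (k j0) - leaf_lo R (k j0)) / (hi v0 - lo v0))" if "x \<in> {lo v0..<hi v0}" for x
      using g_leaf[OF j0(1), of x] that j0 by simp
  qed
  then obtain p where p: "p \<in> I v" "attracting g p" "\<And>x. x \<in> I v0 \<Longrightarrow> g x = x \<longleftrightarrow> x = p"
    using k0 unfolding I_def by (metis atLeastLessThan_iff order.trans order.strict_trans2)
  obtain k1 where k1: "k1 \<le> n" "leaf_lo R k1 = lo w0" "leaf_hi R k1 = hi w0"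
    using leaf_index[OF w(2)] R by (auto simp: lo_def hi_def)
  have "lo w0 \<in> circle" using bnd[of w0] by (auto simp: circle_def)
  \<comment> \<open>A preimage of the left end of \<open>w0\<close> identifies the leaf
    \<open>j1\<close> of \<open>S\<close> that is mapped onto the leaf \<open>w0\<close> of
    \<open>R\<close>.\<close>
  then obtain y where y: "y \<in> circle" "g y = lo w0"
    using bij unfolding bij_betw_def by (metis imageE)
  obtain j1 where j1: "j1 \<le> n" "y \<in> {leaf_lo S j1..<leaf_hi S j1}"
    using leaf_unique[OF y(1), of S] S by blast
  have "lo w0 \<in> {leaf_lo R (k j1)..<leaf_hi R (k j1)}"
    using g_bij[OF j1(1)] j1(2) bij_betwE y(2) by metis
  moreover have "lo w0 \<in> {leaf_lo R k1..<leaf_hi R k1}"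
    using k1 bnd by auto
  ultimately have kk: "k j1 = k1"
    using leaf_unique[OF \<open>lo w0 \<in> circle\<close>, of R] k1(1) kn[of j1] R by blast
  \<comment> \<open>A point of leaf \<open>j1\<close> outside \<open>w\<close> would force the whole
    image leaf \<open>w0\<close> into \<open>v\<close>, although \<open>w0\<close> and
    \<open>v\<close> are disjoint.\<close>
  have in_w: "x \<in> I w" if "x \<in> {leaf_lo S j1..<leaf_hi S j1}" for x
  proof (rule ccontr)
    assume "x \<notin> I w"
    from out[OF j1(1) that this] have "lo w0 \<in> I v"
      using kk k1 bnd[of w0] by (auto simp: I_def)
    then show False using disj2 bnd[of w0] by (auto simp: I_def)
  qed
  have lj1: "leaf_lo S j1 < leaf_hi S j1" using leaf_bounds j1 S by auto
  have j1w: "lo w \<le> leaf_lo S j1" "leaf_hi S j1 \<le> hi w"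
    using lj1 atLeastLessThan_subset_iff[of "leaf_lo S j1" "leaf_hi S j1" "lo w" "hi w"] in_w
    by (auto simp: I_def subset_iff)
  have j1c: "{leaf_lo S j1..<leaf_hi S j1} \<subseteq> circle"
    using leaf_bounds[of j1 S] j1 S by (auto simp: circle_def)
  have inv: "inv_into circle g x = leaf_lo S j1 +
      (x - lo w0) * ((leaf_hi S j1 - leaf_lo S j1) / (hi w0 - lo w0))" (is "_ = ?z")
    if "x \<in> {lo w0..<hi w0}" for x
  proof (rule inv_into_f_eq)
    show "inj_on g circle" using bij by (simp add: bij_betw_def)
    have z: "?z \<in> {leaf_lo S j1..<leaf_hi S j1}"
      using affine_bij_betw[OF bnd(2)[of w0] lj1] that bij_betwE by blast
    then show "?z \<in> circle" using j1c by blast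
    show "g ?z = x"
      using g_leaf[OF j1(1) z] kk k1 bnd(2)[of w0] lj1 by simp
  qed
  have "\<exists>q\<in>{leaf_lo S j1..<leaf_hi S j1}. attracting (inv_into circle g) q \<and>
      (\<forall>x\<in>{lo w0..<hi w0}. inv_into circle g x = x \<longleftrightarrow> x = q)"
  proof (rule affine_contraction_attracting[OF bnd(1) bnd(3)])
    show "lo w0 < leaf_lo S j1" "leaf_hi S j1 < hi w0"
      using j1w strict[OF w(3,4), of w0] w by auto
  qed (use lj1 inv in auto)
  then obtain q where q: "q \<in> I w" "attracting (inv_into circle g) q"
    "\<And>x. x \<in> I w0 \<Longrightarrow> inv_into circle g x = x \<longleftrightarrow> x = q"
    using in_w unfolding I_def by metis
  have sub: "I v \<subseteq> I v0" "I w \<subseteq> I w0"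
    using strict[OF v(3,4), of v0] strict[OF w(3,4), of w0] v w by (auto simp: I_def)
  have Ic: "I u \<subseteq> circle" for u using bnd[of u] by (auto simp: I_def circle_def)
  have gq: "g q = q"
  proof -
    have "inv_into circle g q = q" using q sub by auto
    moreover have "g (inv_into circle g q) = q"
      using bij q Ic by (intro f_inv_into_f) (auto simp: bij_betw_def)
    ultimately show ?thesis by simp
  qed
  have pqc: "p \<in> circle" "q \<in> circle"
    using p(1) q(1) Ic by blast+
  have "{x \<in> circle. g x = x} = {p, q}"
  proof (intro set_eqI iffI)
    fix x assume x: "x \<in> {x \<in> circle. g x = x}"
    show "x \<in> {p, q}"
    \<comment> \<open>Inside \<open>w\<close> a fixed point is one of the inverse on the leaf
      \<open>w0\<close>; outside \<open>w\<close> its image, which is the point itself, lies in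
      \<open>v\<close> and hence in the leaf \<open>v0\<close>.\<close>
    proof (cases "x \<in> I w")
      case True
      have "inv_into circle g x = x"
        using x bij by (intro inv_into_f_eq) (auto simp: bij_betw_def)
      then show ?thesis using True q sub by auto
    next
      case False
      then have "x \<in> I v" using out'[of x] x by auto
      then show ?thesis using p(3) sub x by auto
    qed
  qed (use p q gq sub pqc in auto)
  moreover have "p \<noteq> q" using p q disj_vw by auto
  ultimately show ?thesis
    unfolding north_south_def g_def[symmetric] using p q by blast
qed

section \<open>Catalan numbers\<close>

definition trees :: "nat \<Rightarrow> unit tree set" where
  "trees n = {t. size t = n}"

definition catalan :: "nat \<Rightarrow> nat" where
  "catalan n = card (trees n)"

lemma finite_trees: "finite (trees n)"
  unfolding trees_def by (rule finite_unit_trees)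

definition join :: "unit tree \<times> unit tree \<Rightarrow> unit tree" where
  "join = (\<lambda>(l, r). Node l () r)"

text \<open>The size of the left child determines \<open>k\<close>, so the union is disjoint and its
  cardinality is a convolution. Arbitrary families are allowed because the same count is needed for
  pairs with one exceptional member.\<close>

lemma card_join_UN:
  assumes "\<And>k. A k \<subseteq> trees k" "\<And>k. B k \<subseteq> trees k" "I \<subseteq> {..m}"
  shows "card (join ` (\<Union>k\<in>I. A k \<times> B (m - k))) = (\<Sum>k\<in>I. card (A k) * card (B (m - k)))"
proof -
  have "inj_on join X" for X
    by (auto simp: join_def inj_on_def)
  then have "card (join ` (\<Union>k\<in>I. A k \<times> B (m - k))) = card (\<Union>k\<in>I. A k \<times> B (m - k))"
    by (rule card_image)
  also have "\<dots> = (\<Sum>k\<in>I. card (A k \<times> B (m - k)))"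
  proof (rule card_UN_disjoint)
    show "finite I" using assms(3) finite_subset by blast
    show "\<forall>k\<in>I. finite (A k \<times> B (m - k))"
      using assms finite_trees by (meson finite_SigmaI finite_subset)
    show "\<forall>i\<in>I. \<forall>j\<in>I. i \<noteq> j \<longrightarrow> A i \<times> B (m - i) \<inter> A j \<times> B (m - j) = {}"
      by (auto simp: trees_def dest!: subsetD[OF assms(1)])
  qed
  finally show ?thesis by (simp add: card_cartesian_product)
qed

lemma trees_Suc: "trees (Suc m) = join ` (\<Union>k\<le>m. trees k \<times> trees (m - k))"
proof (intro set_eqI iffI)
  fix t assume t: "t \<in> trees (Suc m)"
  then obtain l r where "t = Node l () r"
    by (cases t) (auto simp: trees_def)
  with t show "t \<in> join ` (\<Union>k\<le>m. trees k \<times> trees (m - k))"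
    by (intro image_eqI[of _ _ "(l, r)"]) (auto simp: trees_def join_def)
qed (auto simp: trees_def join_def)

lemma catalan_Suc: "catalan (Suc m) = (\<Sum>k\<le>m. catalan k * catalan (m - k))"
  unfolding catalan_def trees_Suc by (rule card_join_UN) auto

lemma catalan_0: "catalan 0 = 1"
proof -
  have "trees 0 = {Leaf}" by (auto simp: trees_def)
  then show ?thesis by (simp add: catalan_def)
qed

text \<open>
  The series \<open>F = 1 - 2XC\<close> is a square root of \<open>1 - 4X\<close>, hence
  \<open>(1 - 4X)F' = -2F\<close>, which is a first-order recurrence for the coefficients.
\<close>

lemma catalan_ratio: "(n + 2) * catalan (Suc n) = (4 * n + 2) * catalan n"
proof -
  define C where "C = Abs_fps (\<lambda>n. real (catalan n))"
  define F where "F = 1 - 2 * (fps_X * C)"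
  have CC: "fps_nth (C * C) m = real (catalan (Suc m))" for m
    by (simp add: C_def catalan_Suc fps_mult_nth atMost_atLeast0)
  have C: "C = 1 + fps_X * (C * C)"
  proof (rule fps_ext)
    fix n
    show "fps_nth C n = fps_nth (1 + fps_X * (C * C)) n"
      by (cases n) (simp_all add: CC, simp_all add: C_def catalan_0)
  qed
  have "F * F = 1 - 4 * fps_X * C + 4 * fps_X * (fps_X * (C * C))"
    by (simp add: F_def algebra_simps)
  also have "fps_X * (C * C) = C - 1"
    using C by (metis add_diff_cancel_left')
  finally have FF: "F * F = 1 - 4 * fps_X"
    by (simp add: algebra_simps)
  have "fps_deriv (F * F) = - 4"
    unfolding FF by simp
  then have "2 * (F * fps_deriv F) = 2 * (- 2)"
    by (simp add: algebra_simps)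
  then have FF': "F * fps_deriv F = - 2"
    by (simp only: mult_cancel_left) simp
  have "(1 - 4 * fps_X) * fps_deriv F = F * (F * fps_deriv F)"
    by (simp add: FF[symmetric] mult.assoc)
  then have eq: "fps_deriv F - 4 * (fps_X * fps_deriv F) = - 2 * F"
    by (simp add: FF' algebra_simps)
  have F_Suc: "fps_nth F (Suc k) = - 2 * real (catalan k)" for k
    by (simp add: F_def C_def numeral_fps_const)
  \<comment> \<open>\<open>F\<close> carries the \<open>k\<close>-th Catalan number in degree
    \<open>Suc k\<close>, so the relation between indices \<open>n\<close> and \<open>Suc n\<close>
    is read off in degree \<open>Suc n\<close>.\<close>
  have "fps_nth (fps_deriv F - 4 * (fps_X * fps_deriv F)) (Suc n) = fps_nth (- 2 * F) (Suc n)"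
    by (simp add: eq)
  then have "real (n + 2) * fps_nth F (Suc (Suc n)) - 4 * (real (n + 1) * fps_nth F (Suc n)) = - 2 * fps_nth F (Suc n)"
    by (simp add: numeral_fps_const del: fps_const_neg)
  then have "real ((n + 2) * catalan (Suc n)) = real ((4 * n + 2) * catalan n)"
    by (simp add: F_Suc algebra_simps)
  then show ?thesis by (simp only: of_nat_eq_iff)
qed

section \<open>Catalan numbers scaled by their growth rate 4\<close>

definition catw :: "nat \<Rightarrow> real" where
  "catw n = real (catalan n) / 4 ^ n"

lemma catw_Suc: "catw (Suc n) * (2 * real n + 4) = catw n * (2 * real n + 1)"
proof -
  have "catw (Suc n) * (2 * real n + 4) = 2 * real ((n + 2) * catalan (Suc n)) / 4 ^ Suc n"
    by (simp add: catw_def algebra_simps)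
  also have "\<dots> = catw n * (2 * real n + 1)"
    unfolding catalan_ratio by (simp add: catw_def field_simps)
  finally show ?thesis .
qed

lemma catw_nonneg: "0 \<le> catw n"
  by (simp add: catw_def)

text \<open>Telescoping: \<open>catw_Suc\<close> says that \<open>catw n\<close> is the difference
  of \<open>2 * (real n + 1) * catw n\<close> and the same expression at
  \<open>Suc n\<close>.\<close>

lemma sum_catw: "(\<Sum>k<n. catw k) = 2 - 2 * (real n + 1) * catw n"
proof (induction n)
  case 0
  then show ?case by (simp add: catw_def catalan_0)
next
  case (Suc n)
  then show ?case using catw_Suc[of n] by (simp add: algebra_simps)
qed

lemma summable_catw: "summable catw"
  by (rule summableI_nonneg_bounded[where x = 2])
    (simp_all add: catw_nonneg sum_catw)

text \<open>The recurrence turns one step into comparing the factors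
  \<open>(n + 1) * (n + 1/2)\<close> and \<open>n * (n + 1)\<close>. This crude polynomial lower
  bound on the decay is all that doubling needs.\<close>

lemma catw_growth:
  assumes "l \<le> n"
  shows "real l * (real l + 1) * catw l \<le> real n * (real n + 1) * catw n"
  using assms
proof (induction n rule: dec_induct)
  case (step n)
  have "real (Suc n) * (real (Suc n) + 1) * catw (Suc n) = (real n + 1) / 2 * (catw (Suc n) * (2 * real n + 4))"
    by (simp add: field_simps)
  also have "\<dots> = (real n + 1) / 2 * (2 * real n + 1) * catw n"
    unfolding catw_Suc by simp
  also have "\<dots> \<ge> real n * (real n + 1) * catw n"
    by (intro mult_right_mono) (auto simp: catw_nonneg field_simps)
  finally show ?case using step.IH by simp
qed simp

text \<open>Intended for \<open>l\<close> the larger part of a split of \<open>m\<close> and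
  \<open>n = Suc m\<close>: then \<open>m \<le> 2 * l\<close>. The constant comes from
  \<open>(2 * l + 1) * (2 * l + 2) \<le> 12 * l * (l + 1)\<close>.\<close>

lemma catw_doubling:
  assumes "1 \<le> l" "l \<le> n" "n \<le> 2 * l + 1"
  shows "catw l \<le> 12 * catw n"
proof -
  have "real n * (real n + 1) \<le> (2 * real l + 1) * (2 * real l + 2)"
    using assms by (intro mult_mono) auto
  also have "\<dots> \<le> 12 * (real l * (real l + 1))"
  proof -
    have "(2 * real l + 1) * (2 * (real l + 1)) \<le> (6 * real l) * (2 * (real l + 1))"
      using assms by (intro mult_right_mono) auto
    then show ?thesis by (simp add: algebra_simps)
  qed
  finally have "real n * (real n + 1) * catw n \<le> 12 * (real l * (real l + 1)) * catw n"
    by (rule mult_right_mono) (rule catw_nonneg)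
  then have "(real l * (real l + 1)) * catw l \<le> (real l * (real l + 1)) * (12 * catw n)"
    using catw_growth[OF assms(2)] by (simp add: algebra_simps)
  then show ?thesis
    using assms(1) by (subst (asm) mult_le_cancel_left_pos) auto
qed

text \<open>The asymptotics \<open>C_n = \<Theta>(4^n n^{-3/2})\<close> would give this; summability and doubling suffice.\<close>

lemma balanced_splits_rare:
  assumes "0 < (e :: real)"
  shows "\<exists>K. \<forall>m. (\<Sum>k | k \<le> m \<and> K < k \<and> K < m - k. real (catalan k * catalan (m - k)))
    \<le> e * real (catalan (Suc m))"
proof -
  \<comment> \<open>Below, this tail bound is used twice, multiplied by 12 from doubling and divided
    by 4 from passing from \<open>4 ^ m\<close> to \<open>4 ^ Suc m\<close>:
    \<open>12 * (e/6 + e/6) / 4 = e\<close>.\<close>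
  obtain K where K: "\<And>a b. a \<ge> K \<Longrightarrow> norm (\<Sum>k=a..<b. catw k) < e / 6"
    using summable_catw assms unfolding summable_Cauchy by (metis divide_pos_pos zero_less_numeral)
  have "(\<Sum>k | k \<le> m \<and> K < k \<and> K < m - k. real (catalan k * catalan (m - k)))
    \<le> e * real (catalan (Suc m))" for m
  proof -
    define I where "I = {k. k \<le> m \<and> K < k \<and> K < m - k}"
    have finI: "finite I" by (simp add: I_def)
    \<comment> \<open>The larger part has weight comparable to that of \<open>Suc m\<close>; the
      other factor, with index above \<open>K\<close>, belongs to the tail of a convergent
      series.\<close>
    have t: "catw k * catw (m - k) \<le> 12 * catw (Suc m) * (catw k + catw (m - k))" if "k \<in> I" for k
    proof (cases "k \<le> m - k")
      case True
      then have "catw (m - k) \<le> 12 * catw (Suc m)"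
        using that by (intro catw_doubling) (auto simp: I_def)
      then have "catw k * catw (m - k) \<le> catw k * (12 * catw (Suc m))"
        by (intro mult_left_mono catw_nonneg)
      also have "\<dots> \<le> (catw k + catw (m - k)) * (12 * catw (Suc m))"
        by (intro mult_right_mono) (auto simp: catw_nonneg)
      finally show ?thesis by (simp add: algebra_simps)
    next
      case False
      then have "catw k \<le> 12 * catw (Suc m)"
        using that by (intro catw_doubling) (auto simp: I_def)
      then have "catw k * catw (m - k) \<le> (12 * catw (Suc m)) * catw (m - k)"
        by (intro mult_right_mono catw_nonneg)
      also have "\<dots> \<le> (12 * catw (Suc m)) * (catw k + catw (m - k))"
        by (intro mult_left_mono) (auto simp: catw_nonneg)
      finally show ?thesis by simp
    qed
    have "(\<Sum>k\<in>I. catw k) \<le> (\<Sum>k=K..<Suc m. catw k)"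
      by (rule sum_mono2) (auto simp: I_def catw_nonneg)
    then have s1: "(\<Sum>k\<in>I. catw k) \<le> e / 6"
      using K[of K "Suc m"] by simp
    have s2: "(\<Sum>k\<in>I. catw (m - k)) = (\<Sum>k\<in>I. catw k)"
      by (rule sum.reindex_bij_witness[where i = "\<lambda>k. m - k" and j = "\<lambda>k. m - k"]) (auto simp: I_def)
    have "(\<Sum>k\<in>I. catw k * catw (m - k)) \<le> (\<Sum>k\<in>I. 12 * catw (Suc m) * (catw k + catw (m - k)))"
      by (rule sum_mono) (rule t)
    also have "\<dots> = 12 * catw (Suc m) * ((\<Sum>k\<in>I. catw k) + (\<Sum>k\<in>I. catw (m - k)))"
      unfolding sum.distrib[symmetric] sum_distrib_left ..
    also have "\<dots> \<le> 12 * catw (Suc m) * (e / 6 + e / 6)"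
      unfolding s2 using s1 by (intro mult_left_mono add_mono) (auto simp: catw_nonneg)
    finally have "4 ^ m * (\<Sum>k\<in>I. catw k * catw (m - k)) \<le> 4 ^ m * (4 * e * catw (Suc m))"
      by (intro mult_left_mono) auto
    also have "\<dots> = e * real (catalan (Suc m))"
      by (simp add: catw_def)
    also have "4 ^ m * (\<Sum>k\<in>I. catw k * catw (m - k)) = (\<Sum>k\<in>I. real (catalan k * catalan (m - k)))"
      unfolding sum_distrib_left
    proof (rule sum.cong)
      fix k assume "k \<in> I"
      then have "(4::real) ^ m = 4 ^ k * 4 ^ (m - k)"
        by (simp add: I_def power_add[symmetric])
      then show "4 ^ m * (catw k * catw (m - k)) = real (catalan k * catalan (m - k))"
        by (simp add: catw_def)
    qed simp
    finally show ?thesis by (simp add: I_def)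
  qed
  then show ?thesis by blast
qed


section \<open>The large node at a given depth\<close>

definition light :: "nat \<Rightarrow> nat \<Rightarrow> nat \<Rightarrow> unit tree set" where
  "light D K n = {t \<in> trees n. \<forall>u s. length u = D \<longrightarrow> subtree_at u t = Some s \<longrightarrow> size s + K < n}"

lemma light_subset: "light D K n \<subseteq> trees n"
  by (auto simp: light_def)

text \<open>Split at the root. If one side has at most \<open>K'\<close> nodes, a node at depth
  \<open>D\<close> of the other side that misses at most \<open>K\<close> there misses at most
  \<open>K + K' + 1\<close> in the whole tree, the 1 being the root. So the big side must itself be
  exceptional, unless both sides are big.\<close>

lemma light_Suc_subset:
  "light (Suc D) (K + K' + 1) (Suc m) \<subseteq>
     join ` (\<Union>k\<in>{k. k \<le> m \<and> K' < k \<and> K' < m - k}. trees k \<times> trees (m - k)) \<union>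
     (join ` (\<Union>k\<in>{k. k \<le> m \<and> m - k \<le> K'}. light D K k \<times> trees (m - k)) \<union>
      join ` (\<Union>k\<in>{k. k \<le> m \<and> k \<le> K'}. trees k \<times> light D K (m - k)))"
proof
  fix t assume t: "t \<in> light (Suc D) (K + K' + 1) (Suc m)"
  then obtain l r where lr: "t = Node l () r"
    by (cases t) (auto simp: light_def trees_def)
  have sz: "size l + size r = m"
    using t lr by (auto simp: light_def trees_def)
  have ll: "l \<in> light D K (size l)" if "size r \<le> K'"
  proof -
    have "size s + K < size l" if "length u = D" "subtree_at u l = Some s" for u s
      using t that \<open>size r \<le> K'\<close> sz unfolding light_def lr
      by (auto dest!: spec[of _ "False # u"])
    then show ?thesis by (auto simp: light_def trees_def)
  qed
  have lr': "r \<in> light D K (size r)" if "size l \<le> K'"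
  proof -
    have "size s + K < size r" if "length u = D" "subtree_at u r = Some s" for u s
      using t that \<open>size l \<le> K'\<close> sz unfolding light_def lr
      by (auto dest!: spec[of _ "True # u"])
    then show ?thesis by (auto simp: light_def trees_def)
  qed
  have j: "t = join (l, r)" by (simp add: join_def lr)
  have mk: "size l \<le> m" "m - size l = size r" using sz by auto
  have tr: "l \<in> trees (size l)" "r \<in> trees (size r)" by (auto simp: trees_def)
  consider "size r \<le> K'" | "size l \<le> K'" | "K' < size l" "K' < size r" by linarith
  then show "t \<in> join ` (\<Union>k\<in>{k. k \<le> m \<and> K' < k \<and> K' < m - k}. trees k \<times> trees (m - k)) \<union>
     (join ` (\<Union>k\<in>{k. k \<le> m \<and> m - k \<le> K'}. light D K k \<times> trees (m - k)) \<union>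
      join ` (\<Union>k\<in>{k. k \<le> m \<and> k \<le> K'}. trees k \<times> light D K (m - k)))"
  proof cases
    case 1
    then have "(l, r) \<in> (\<Union>k\<in>{k. k \<le> m \<and> m - k \<le> K'}. light D K k \<times> trees (m - k))"
      using ll mk tr by (intro UN_I[of "size l"]) auto
    then show ?thesis unfolding j by blast
  next
    case 2
    then have "(l, r) \<in> (\<Union>k\<in>{k. k \<le> m \<and> k \<le> K'}. trees k \<times> light D K (m - k))"
      using lr' mk tr by (intro UN_I[of "size l"]) auto
    then show ?thesis unfolding j by blast
  next
    case 3
    then have "(l, r) \<in> (\<Union>k\<in>{k. k \<le> m \<and> K' < k \<and> K' < m - k}. trees k \<times> trees (m - k))"
      using mk tr by (intro UN_I[of "size l"]) auto
    then show ?thesis unfolding j by blast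
  qed
qed

lemma light_trees_rare:
  assumes "0 < (e :: real)"
  shows "\<exists>K n0. \<forall>n\<ge>n0. real (card (light D K n)) \<le> e * real (catalan n)"
  using assms
proof (induction D arbitrary: e)
  case 0
  have "light 0 0 n = {}" for n
    by (auto simp: light_def trees_def)
  then show ?case using 0 by (intro exI[of _ 0]) auto
next
  case (Suc D)
  have "0 < e / 3" using Suc.prems by simp
  from Suc.IH[OF this] obtain K n0 where K: "\<And>n. n \<ge> n0 \<Longrightarrow> real (card (light D K n)) \<le> e / 3 * real (catalan n)"
    by blast
  from balanced_splits_rare[OF \<open>0 < e / 3\<close>] obtain K' where
    K': "\<And>m. (\<Sum>k | k \<le> m \<and> K' < k \<and> K' < m - k. real (catalan k * catalan (m - k)))
      \<le> e / 3 * real (catalan (Suc m))" by blast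
  \<comment> \<open>With \<open>m \<ge> n0 + K'\<close>, a side whose sibling has at most
    \<open>K'\<close> nodes has at least \<open>n0\<close>, so the induction hypothesis applies to
    it. The three kinds of split cost \<open>e / 3\<close> each.\<close>
  have "real (card (light (Suc D) (K + K' + 1) n)) \<le> e * real (catalan n)" if "n \<ge> Suc (n0 + K')" for n
  proof -
    obtain m where m: "n = Suc m" "m \<ge> n0 + K'" using \<open>n \<ge> _\<close> by (cases n) auto
    define X where "X = join ` (\<Union>k\<in>{k. k \<le> m \<and> K' < k \<and> K' < m - k}. trees k \<times> trees (m - k))"
    define Y where "Y = join ` (\<Union>k\<in>{k. k \<le> m \<and> m - k \<le> K'}. light D K k \<times> trees (m - k))"
    define Z where "Z = join ` (\<Union>k\<in>{k. k \<le> m \<and> k \<le> K'}. trees k \<times> light D K (m - k))"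
    have fin: "finite X" "finite Y" "finite Z"
      unfolding X_def Y_def Z_def
      by (auto intro!: finite_imageI finite_SigmaI finite_trees finite_subset[OF light_subset finite_trees])
    have "card (light (Suc D) (K + K' + 1) n) \<le> card (X \<union> (Y \<union> Z))"
      unfolding m(1) using fin light_Suc_subset[of D K K' m] by (intro card_mono) (auto simp: X_def Y_def Z_def)
    also have "\<dots> \<le> card X + (card Y + card Z)"
      by (meson add_left_mono card_Un_le le_trans)
    finally have le: "real (card (light (Suc D) (K + K' + 1) n)) \<le> real (card X) + (real (card Y) + real (card Z))"
      by linarith
    have cat: "(\<Sum>k\<in>J. e / 3 * real (catalan k * catalan (m - k))) \<le> e / 3 * real (catalan (Suc m))"
      if "J \<subseteq> {..m}" for J
    proof -
      have "(\<Sum>k\<in>J. e / 3 * real (catalan k * catalan (m - k))) \<le>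
          (\<Sum>k\<le>m. e / 3 * real (catalan k * catalan (m - k)))"
        using that Suc.prems by (intro sum_mono2) auto
      also have "\<dots> = e / 3 * real (catalan (Suc m))"
        by (simp add: catalan_Suc sum_distrib_left)
      finally show ?thesis .
    qed
    have "card X = (\<Sum>k | k \<le> m \<and> K' < k \<and> K' < m - k. catalan k * catalan (m - k))"
      unfolding X_def catalan_def by (rule card_join_UN) auto
    then have X: "real (card X) \<le> e / 3 * real (catalan (Suc m))"
      using K'[of m] by simp
    have "card Y = (\<Sum>k | k \<le> m \<and> m - k \<le> K'. card (light D K k) * catalan (m - k))"
      unfolding Y_def catalan_def by (rule card_join_UN) (auto simp: light_subset)
    then have "real (card Y) = (\<Sum>k | k \<le> m \<and> m - k \<le> K'. real (card (light D K k)) * real (catalan (m - k)))"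
      by simp
    also have "\<dots> \<le> (\<Sum>k | k \<le> m \<and> m - k \<le> K'. e / 3 * real (catalan k * catalan (m - k)))"
    proof (rule sum_mono)
      fix k assume "k \<in> {k. k \<le> m \<and> m - k \<le> K'}"
      then have "real (card (light D K k)) \<le> e / 3 * real (catalan k)"
        using m by (intro K) auto
      then have "real (card (light D K k)) * real (catalan (m - k)) \<le> e / 3 * real (catalan k) * real (catalan (m - k))"
        by (rule mult_right_mono) simp
      then show "real (card (light D K k)) * real (catalan (m - k)) \<le> e / 3 * real (catalan k * catalan (m - k))"
        by simp
    qed
    also have "\<dots> \<le> e / 3 * real (catalan (Suc m))"
      by (rule cat) auto
    finally have Y: "real (card Y) \<le> e / 3 * real (catalan (Suc m))" .
    have "card Z = (\<Sum>k | k \<le> m \<and> k \<le> K'. catalan k * card (light D K (m - k)))"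
      unfolding Z_def catalan_def by (rule card_join_UN) (auto simp: light_subset)
    then have "real (card Z) = (\<Sum>k | k \<le> m \<and> k \<le> K'. real (catalan k) * real (card (light D K (m - k))))"
      by simp
    also have "\<dots> \<le> (\<Sum>k | k \<le> m \<and> k \<le> K'. e / 3 * real (catalan k * catalan (m - k)))"
    proof (rule sum_mono)
      fix k assume "k \<in> {k. k \<le> m \<and> k \<le> K'}"
      then have "real (card (light D K (m - k))) \<le> e / 3 * real (catalan (m - k))"
        using m by (intro K) auto
      then have "real (catalan k) * real (card (light D K (m - k))) \<le> real (catalan k) * (e / 3 * real (catalan (m - k)))"
        by (rule mult_left_mono) simp
      then show "real (catalan k) * real (card (light D K (m - k))) \<le> e / 3 * real (catalan k * catalan (m - k))"
        by (simp add: algebra_simps)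
    qed
    also have "\<dots> \<le> e / 3 * real (catalan (Suc m))"
      by (rule cat) auto
    finally have Z: "real (card Z) \<le> e / 3 * real (catalan (Suc m))" .
    show ?thesis using le X Y Z by (simp add: m(1))
  qed
  then show ?case by blast
qed

section \<open>Equidistribution of the address of the large node\<close>

definition heavy :: "nat \<Rightarrow> bool list \<Rightarrow> nat \<Rightarrow> unit tree set" where
  "heavy K u n = {t \<in> trees n. \<exists>s. subtree_at u t = Some s \<and> n \<le> size s + K}"

lemma not_light_heavy:
  assumes "t \<in> trees n" "t \<notin> light D K n"
  obtains u where "length u = D" "t \<in> heavy K u n"
  using assms by (force simp: light_def heavy_def not_less)

text \<open>Children are exchanged along the path \<open>u\<close> so that it becomes the path
  \<open>v\<close>, while all subtrees hanging off it are kept. Exchanging the two words undoes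
  this, which makes it a size-preserving bijection.\<close>

fun transplant :: "bool list \<Rightarrow> bool list \<Rightarrow> 'a tree \<Rightarrow> 'a tree" where
  "transplant (c # u) (c' # v) (Node l x r) =
     (let s = transplant u v (if c then r else l); s' = (if c then l else r)
      in if c' then Node s' x s else Node s x s')"
| "transplant _ _ t = t"

lemma transplant:
  assumes "length u = length v"
  shows "subtree_at v (transplant u v t) = subtree_at u t"
    and "transplant v u (transplant u v t) = t"
    and "size (transplant u v t) = size t"
  using assms by (induction u v t rule: transplant.induct) (auto simp: Let_def subtree_at_Leaf)

lemma card_heavy_cong:
  assumes "length u = length v"
  shows "card (heavy K u n) = card (heavy K v n)"
proof (rule bij_betw_same_card[OF bij_betw_byWitness[where f' = "transplant v u"]])
  show "transplant u v ` heavy K u n \<subseteq> heavy K v n" "transplant v u ` heavy K v n \<subseteq> heavy K u n"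
    using assms by (auto simp: heavy_def trees_def transplant)
qed (use assms in \<open>auto simp: transplant\<close>)

lemma card_words: "card {u :: bool list. length u = k} = 2 ^ k" "finite {u :: bool list. length u = k}"
  using card_lists_length_eq[of "UNIV :: bool set" k] finite_lists_length_eq[of "UNIV :: bool set" k]
  by auto

text \<open>The classes for the \<open>2 ^ length u\<close> addresses of this length are
  equinumerous by transplanting, and disjoint because two disjoint subtrees cannot each miss at most
  \<open>K\<close> of \<open>n \<ge> 2 * K\<close> nodes.\<close>

lemma card_heavy_le:
  assumes "2 * K \<le> n"
  shows "2 ^ length u * card (heavy K u n) \<le> catalan n"
proof -
  define W where "W = {v :: bool list. length v = length u}"
  have "card (\<Union>v\<in>W. heavy K v n) = (\<Sum>v\<in>W. card (heavy K v n))"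
  proof (rule card_UN_disjoint)
    show "finite W" unfolding W_def by (rule card_words)
    show "\<forall>v\<in>W. finite (heavy K v n)"
      using finite_trees by (auto simp: heavy_def)
    show "\<forall>v\<in>W. \<forall>v'\<in>W. v \<noteq> v' \<longrightarrow> heavy K v n \<inter> heavy K v' n = {}"
    proof (intro ballI impI equals0I)
      fix v v' t assume v: "v \<in> W" "v' \<in> W" "v \<noteq> v'" "t \<in> heavy K v n \<inter> heavy K v' n"
      then obtain s s' where "subtree_at v t = Some s" "n \<le> size s + K"
        "subtree_at v' t = Some s'" "n \<le> size s' + K" "size t = n"
        by (auto simp: heavy_def trees_def)
      then show False
        using subtree_at_disjoint[of v t s v' s'] v assms by (auto simp: W_def)
    qed
  qed
  also have "\<dots> = (\<Sum>v\<in>W. card (heavy K u n))"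
    by (rule sum.cong) (auto simp: W_def intro: card_heavy_cong)
  also have "\<dots> = 2 ^ length u * card (heavy K u n)"
    by (simp add: W_def card_words)
  finally have "2 ^ length u * card (heavy K u n) = card (\<Union>v\<in>W. heavy K v n)" by simp
  also have "\<dots> \<le> catalan n"
    unfolding catalan_def by (rule card_mono[OF finite_trees]) (auto simp: heavy_def)
  finally show ?thesis .
qed


section \<open>Counting diagrams\<close>

text \<open>The ancestor of a heavy node is at least as heavy, and a level has room for only one
  heavy node; so the nodes chosen at the two depths lie on one path.\<close>

lemma heavy_take:
  assumes "t \<in> heavy K u n" "t \<in> heavy K' u' n" "length u' \<le> length u" "K + K' \<le> n"
  shows "take (length u') u = u'"
proof (rule ccontr)
  assume ne: "take (length u') u \<noteq> u'"
  obtain s s' where s: "subtree_at u t = Some s" "n \<le> size s + K"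
    "subtree_at u' t = Some s'" "n \<le> size s' + K'" "size t = n"
    using assms by (auto simp: heavy_def trees_def)
  obtain s'' where s'': "subtree_at (take (length u') u) t = Some s''" "size s \<le> size s''"
    using subtree_at_append[of "take (length u') u" "drop (length u') u" t s] s by auto
  have "size s'' + size s' < size t"
    using ne s assms by (intro subtree_at_disjoint[OF s''(1) s(3)]) auto
  then show False using s s'' assms by simp
qed

text \<open>The addresses to be avoided: below a leaf of depth at most \<open>k\<close>, only these
  can fail to turn both left and right.\<close>

definition const_tail_words :: "nat \<Rightarrow> nat \<Rightarrow> bool list set" where
  "const_tail_words k D = (\<lambda>(x, b). x @ replicate D b) ` ({x. length x = k} \<times> UNIV)"

lemma card_const_tail_words: "card (const_tail_words k D) \<le> 2 * 2 ^ k"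
proof -
  have "card (const_tail_words k D) \<le> card ({x :: bool list. length x = k} \<times> (UNIV :: bool set))"
    unfolding const_tail_words_def using card_words by (intro card_image_le) auto
  then show ?thesis by (simp add: card_cartesian_product card_words)
qed

lemma finite_const_tail_words: "finite (const_tail_words k D)"
  unfolding const_tail_words_def using card_words by auto

lemma set_drop_not_const_tail:
  assumes "length u = k + D" "u \<notin> const_tail_words k D"
  shows "True \<in> set (drop k u)" "False \<in> set (drop k u)"
proof -
  have "drop k u \<noteq> replicate D b" for b
  proof
    assume "drop k u = replicate D b"
    then have "u = take k u @ replicate D b" by (metis append_take_drop_id)
    then have "u \<in> const_tail_words k D"
      using assms(1) unfolding const_tail_words_def by (intro image_eqI[of _ _ "(take k u, b)"]) auto
    then show False using assms by simp
  qed
  moreover have "length (drop k u) = D" using assms(1) by simp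
  ultimately have "\<exists>x\<in>set (drop k u). x \<noteq> b" for b
    using replicate_eqI[of "drop k u" D b] by blast
  then show "True \<in> set (drop k u)" "False \<in> set (drop k u)"
    by (metis (full_types))+
qed

text \<open>The leaf is met within the first \<open>length u + K'\<close> letters, so the last
  \<open>D\<close> letters of \<open>v\<close> all lie below it, and they are not constant.\<close>

lemma heavy_split_at_leaf:
  assumes t: "t \<in> heavy K' u n" and v: "length v = length u + K' + D" "take (length u) v \<noteq> u"
    "v \<notin> const_tail_words (length u + K') D"
  obtains x y where "v = x @ y" "subtree_at x t = Some Leaf" "True \<in> set y" "False \<in> set y"
proof -
  obtain s where "subtree_at u t = Some s" "size t \<le> size s + K'"
    using t by (auto simp: heavy_def trees_def)
  then obtain x y where xy: "v = x @ y" "length x \<le> length u + K'" "subtree_at x t = Some Leaf"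
    using leaving_path_meets_leaf[of u t s K' v] v by auto
  then have "drop (length u + K') v = drop (length u + K' - length x) y"
    by simp
  then have "set (drop (length u + K') v) \<subseteq> set y"
    by (metis set_drop_subset)
  then show ?thesis
    using that xy set_drop_not_const_tail[OF v(1,3)] by blast
qed

lemma heavy_diagram_north_south:
  assumes S: "S \<in> heavy K' u' n" "S \<in> heavy K u n" and R: "R \<in> heavy K' v' n" "R \<in> heavy K v n"
    and len: "length u' = D" "length v' = D" "length u = D + K' + D" "length v = D + K' + D"
    and ne: "u' \<noteq> v'" and tail: "u \<notin> const_tail_words (D + K') D" "v \<notin> const_tail_words (D + K') D"
    and n: "K + K' \<le> n" "K < n" and i: "2 * K \<le> i" "i + 2 * K \<le> n"
  shows "north_south (diagram_map (S, R, i))"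
proof -
  have tk: "take D u = u'" "take D v = v'"
    using heavy_take[OF S(2,1)] heavy_take[OF R(2,1)] len n by auto
  \<comment> \<open>The roles cross over: \<open>v\<close>, taken from \<open>R\<close>, is followed
    in \<open>S\<close>. It starts with \<open>v'\<close> and so leaves the path to the heavy node
    \<open>u'\<close> of \<open>S\<close> within \<open>D\<close> letters.\<close>
  obtain v0 v1 where v: "v = v0 @ v1" "subtree_at v0 S = Some Leaf" "True \<in> set v1" "False \<in> set v1"
    using heavy_split_at_leaf[OF S(1), of v D] len tk ne tail by auto
  obtain u0 u1 where u: "u = u0 @ u1" "subtree_at u0 R = Some Leaf" "True \<in> set u1" "False \<in> set u1"
    using heavy_split_at_leaf[OF R(1), of u D] len tk ne tail by auto
  obtain s where s: "size S = n" "subtree_at u S = Some s" "n \<le> size s + K"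
    using S(2) by (auto simp: heavy_def trees_def)
  obtain r where r: "size R = n" "subtree_at v R = Some r" "n \<le> size r + K"
    using R(2) by (auto simp: heavy_def trees_def)
  have "length v = length u" "v \<noteq> u"
    using len tk ne by auto
  from north_south_diagram[OF s r this v u i n(2)] show ?thesis .
qed

text \<open>A union bound over the sets \<open>B1\<close> to \<open>B8\<close>, whose shares are at
  most \<open>e\<close>, except for \<open>2 * e\<close> each for \<open>B6\<close> and
  \<open>B7\<close>; the total is \<open>10 * e\<close>.\<close>

lemma ns_fraction_ge:
  assumes "0 < (e :: real)"
  shows "\<forall>\<^sub>F n in sequentially. 1 - 10 * e \<le> ns_fraction n"
proof -
  obtain D where D: "(1 / 2) ^ D < e"
    using real_arch_pow_inv[OF assms, of "1 / 2"] by auto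
  obtain K' n1 where light1: "\<And>n. n \<ge> n1 \<Longrightarrow> real (card (light D K' n)) \<le> e * real (catalan n)"
    using light_trees_rare[OF assms, of D] by blast
  \<comment> \<open>\<open>D\<close> letters to separate, \<open>K'\<close> more to reach a leaf,
    and \<open>D\<close> below that leaf. The loss \<open>K\<close> depends on \<open>N\<close>, and
    only \<open>n\<close> is chosen after it.\<close>
  define N where "N = D + K' + D"
  obtain K n2 where light2: "\<And>n. n \<ge> n2 \<Longrightarrow> real (card (light N K n)) \<le> e * real (catalan n)"
    using light_trees_rare[OF assms, of N] by blast
  obtain n3 :: nat where n3: "4 * real K / e < real n3"
    using reals_Archimedean2 by blast
  have "1 - 10 * e \<le> ns_fraction n"
    if n: "n \<ge> n1" "n \<ge> n2" "n \<ge> n3" "n \<ge> 2 * (K + K') + 1" for n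
  proof -
    define c where "c = real (catalan n)"
    define T where "T = trees n"
    define W where "W = {u :: bool list. length u = D}"
    define Q where "Q = const_tail_words (D + K') D"
    define M where "M = real (card (marked_diagrams n))"
    have T: "finite T" "card T = catalan n"
      by (auto simp: T_def finite_trees catalan_def)
    have heavyT: "heavy k u n \<subseteq> T" for k u by (auto simp: heavy_def T_def)
    have fin_heavy: "finite (heavy k u n)" for k u
      using heavyT T finite_subset by blast
    have M: "M = (real n + 1) * c * c"
      by (simp add: M_def card_marked_diagrams c_def catalan_def trees_def power2_eq_square algebra_simps)
    have "catalan n \<noteq> 0"
      by (induction n) (auto simp: catalan_0 catalan_Suc)
    then have c: "c > 0" by (simp add: c_def)
    then have Mpos: "M > 0" by (simp add: M)
    define B1 where "B1 = light D K' n \<times> (T \<times> {..n})"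
    define B2 where "B2 = T \<times> (light D K' n \<times> {..n})"
    define B3 where "B3 = light N K n \<times> (T \<times> {..n})"
    define B4 where "B4 = T \<times> (light N K n \<times> {..n})"
    define B5 where "B5 = (\<Union>u\<in>W. heavy K' u n \<times> (heavy K' u n \<times> {..n}))"
    define B6 where "B6 = (\<Union>u\<in>Q. heavy K u n) \<times> (T \<times> {..n})"
    define B7 where "B7 = T \<times> ((\<Union>u\<in>Q. heavy K u n) \<times> {..n})"
    define B8 where "B8 = T \<times> (T \<times> ({..<2 * K} \<union> {n - 2 * K<..n}))"
    define B where "B = B1 \<union> (B2 \<union> (B3 \<union> (B4 \<union> (B5 \<union> (B6 \<union> (B7 \<union> B8))))))"
    define G where "G = {d \<in> marked_diagrams n. north_south (diagram_map d)}"
    have fin_light: "finite (light k l n)" for k l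
      by (rule finite_subset[OF light_subset finite_trees])
    have finB: "finite B"
      unfolding B_def B1_def B2_def B3_def B4_def B5_def B6_def B7_def B8_def
      using T fin_light fin_heavy card_words finite_const_tail_words by (auto simp: W_def Q_def)
    have finG: "finite G" by (simp add: G_def finite_marked_diagrams)
    have "marked_diagrams n \<subseteq> G \<union> B"
    proof
      fix d assume d: "d \<in> marked_diagrams n"
      then obtain S R i where d_eq: "d = (S, R, i)" and SRi: "S \<in> T" "R \<in> T" "i \<le> n"
        by (cases d) (auto simp: marked_diagrams_def T_def trees_def)
      show "d \<in> G \<union> B"
      proof (cases "d \<in> B")
        case False
        then have nl: "S \<notin> light D K' n" "R \<notin> light D K' n" "S \<notin> light N K n" "R \<notin> light N K n"
          using SRi by (auto simp: d_eq B_def B1_def B2_def B3_def B4_def)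
        obtain u' where u': "length u' = D" "S \<in> heavy K' u' n"
          using not_light_heavy[OF _ nl(1)] SRi by (auto simp: T_def)
        obtain v' where v': "length v' = D" "R \<in> heavy K' v' n"
          using not_light_heavy[OF _ nl(2)] SRi by (auto simp: T_def)
        obtain u where u: "length u = N" "S \<in> heavy K u n"
          using not_light_heavy[OF _ nl(3)] SRi by (auto simp: T_def)
        obtain v where v: "length v = N" "R \<in> heavy K v n"
          using not_light_heavy[OF _ nl(4)] SRi by (auto simp: T_def)
        have "u' \<noteq> v'"
          using False SRi u' v' by (auto simp: d_eq B_def B5_def W_def)
        moreover have "u \<notin> Q" "v \<notin> Q"
          using False SRi u v by (auto simp: d_eq B_def B6_def B7_def)
        moreover have "2 * K \<le> i" "i + 2 * K \<le> n"
          using False SRi n by (auto simp: d_eq B_def B8_def)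
        ultimately have "north_south (diagram_map d)"
          unfolding d_eq using u u' v v' n
          by (intro heavy_diagram_north_south[of S K' u' n K u R v' v D]) (auto simp: Q_def N_def)
        then show ?thesis using d by (simp add: G_def)
      qed simp
    qed
    then have "card (marked_diagrams n) \<le> card (G \<union> B)"
      using finG finB by (intro card_mono) auto
    also have "\<dots> \<le> card G + card B"
      by (rule card_Un_le)
    finally have MGB: "M \<le> real (card G) + real (card B)"
      by (simp add: M_def)
    have "card B \<le> card B1 + (card B2 + (card B3 + (card B4 + (card B5 + (card B6 + (card B7 + card B8))))))"
      unfolding B_def by (intro order.trans[OF card_Un_le] add_mono order.refl)
    then have "real (card B) \<le> real (card B1) + (real (card B2) + (real (card B3) + (real (card B4) +
        (real (card B5) + (real (card B6) + (real (card B7) + real (card B8)))))))"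
      by (metis of_nat_add of_nat_le_iff)
    moreover have rare: "real (card (A \<times> (T \<times> {..n}))) \<le> x * M" "real (card (T \<times> (A \<times> {..n}))) \<le> x * M"
      if "real (card A) \<le> x * c" for A x
    proof -
      have "real (card A) * (c * (real n + 1)) \<le> x * c * (c * (real n + 1))"
        using that c by (intro mult_right_mono) auto
      then show "real (card (A \<times> (T \<times> {..n}))) \<le> x * M" "real (card (T \<times> (A \<times> {..n}))) \<le> x * M"
        by (simp_all add: card_cartesian_product T M c_def algebra_simps)
    qed
    have "real (card B1) \<le> e * M" "real (card B2) \<le> e * M"
      unfolding B1_def B2_def by (rule rare; use light1 n in \<open>simp add: c_def\<close>)+
    moreover have "real (card B3) \<le> e * M" "real (card B4) \<le> e * M"
      unfolding B3_def B4_def by (rule rare; use light2 n in \<open>simp add: c_def\<close>)+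
    moreover have "real (card B5) \<le> e * M"
    proof -
      have h: "real (card (heavy K' u n)) \<le> (1 / 2) ^ D * c" if "u \<in> W" for u
      proof -
        have "2 ^ D * card (heavy K' u n) \<le> catalan n"
          using card_heavy_le[of K' n u] n that by (simp add: W_def)
        then have "2 ^ D * real (card (heavy K' u n)) \<le> c"
          unfolding c_def by (metis of_nat_le_iff of_nat_mult of_nat_numeral of_nat_power)
        then show ?thesis by (simp add: field_simps)
      qed
      \<comment> \<open>\<open>S\<close> and \<open>R\<close> vary independently, so each of the
        \<open>2 ^ D\<close> common addresses has share at most
        \<open>(1 / 2 ^ D)^2\<close>.\<close>
      have "card B5 \<le> (\<Sum>u\<in>W. card (heavy K' u n \<times> (heavy K' u n \<times> {..n})))"
        unfolding B5_def by (rule card_UN_le) (simp add: W_def card_words)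
      then have "real (card B5) \<le> (\<Sum>u\<in>W. real (card (heavy K' u n)) * real (card (heavy K' u n)) * (real n + 1))"
        by (simp add: card_cartesian_product algebra_simps flip: of_nat_sum of_nat_mult of_nat_add of_nat_Suc)
      also have "\<dots> \<le> (\<Sum>u\<in>W. ((1 / 2) ^ D * c) * ((1 / 2) ^ D * c) * (real n + 1))"
        using c by (intro sum_mono mult_right_mono mult_mono h) auto
      also have "\<dots> = (2 ^ D * (1 / 2) ^ D) * ((1 / 2) ^ D * M)"
        by (simp add: W_def card_words M)
      also have "\<dots> = (1 / 2) ^ D * M"
        by (simp add: power_mult_distrib[symmetric])
      also have "\<dots> \<le> e * M"
        using D Mpos by (intro mult_right_mono) auto
      finally show ?thesis .
    qed
    moreover have "real (card (\<Union>u\<in>Q. heavy K u n)) \<le> 2 * e * c"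
    proof -
      have h: "real (card (heavy K u n)) \<le> (1 / 2) ^ N * c" if "u \<in> Q" for u
      proof -
        have "length u = N" using that by (auto simp: Q_def const_tail_words_def N_def)
        then have "2 ^ N * card (heavy K u n) \<le> catalan n"
          using card_heavy_le[of K n u] n by simp
        then have "2 ^ N * real (card (heavy K u n)) \<le> c"
          unfolding c_def by (metis of_nat_le_iff of_nat_mult of_nat_numeral of_nat_power)
        then show ?thesis by (simp add: field_simps)
      qed
      have "card (\<Union>u\<in>Q. heavy K u n) \<le> (\<Sum>u\<in>Q. card (heavy K u n))"
        by (rule card_UN_le) (simp add: Q_def finite_const_tail_words)
      then have "real (card (\<Union>u\<in>Q. heavy K u n)) \<le> (\<Sum>u\<in>Q. real (card (heavy K u n)))"
        by (simp flip: of_nat_sum)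
      also have "\<dots> \<le> (\<Sum>u\<in>Q. (1 / 2) ^ N * c)"
        by (rule sum_mono) (rule h)
      also have "\<dots> = real (card Q) * ((1 / 2) ^ N * c)" by simp
      \<comment> \<open>At most \<open>2 * 2 ^ (D + K')\<close> bad words among
        \<open>2 ^ N\<close>, each of share at most \<open>1 / 2 ^ N\<close>, leave
        \<open>2 / 2 ^ D\<close>.\<close>
      also have "\<dots> \<le> real (2 * 2 ^ (D + K')) * ((1 / 2) ^ N * c)"
        using card_const_tail_words[of "D + K'" D] c
        by (intro mult_right_mono of_nat_mono) (auto simp: Q_def)
      also have "\<dots> = 2 * (2 ^ (D + K') * (1 / 2) ^ (D + K')) * (1 / 2) ^ D * c"
        unfolding N_def power_add[of _ "D + K'" D] by simp
      also have "\<dots> = 2 * (1 / 2) ^ D * c"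
        by (simp add: power_mult_distrib[symmetric])
      also have "\<dots> \<le> 2 * e * c"
        using D c by (intro mult_right_mono) auto
      finally show ?thesis .
    qed
    then have "real (card B6) \<le> 2 * e * M" "real (card B7) \<le> 2 * e * M"
      unfolding B6_def B7_def by (rule rare)+
    moreover have "real (card B8) \<le> e * M"
    proof -
      have "card ({..<2 * K} \<union> {n - 2 * K<..n}) \<le> card {..<2 * K} + card {n - 2 * K<..n}"
        by (rule card_Un_le)
      then have "real (card ({..<2 * K} \<union> {n - 2 * K<..n})) \<le> 4 * real K"
        by simp
      also have "\<dots> \<le> e * (real n + 1)"
      proof -
        have "4 * real K / e \<le> real n + 1" using n3 n by linarith
        then show ?thesis using assms by (simp add: field_simps)
      qed
      finally have "c * (c * real (card ({..<2 * K} \<union> {n - 2 * K<..n}))) \<le> c * (c * (e * (real n + 1)))"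
        using c by (intro mult_left_mono) auto
      then show ?thesis
        unfolding B8_def card_cartesian_product T M by (simp add: c_def algebra_simps)
    qed
    ultimately have "real (card B) \<le> 10 * e * M" by linarith
    then have "(1 - 10 * e) * M \<le> real (card G)"
      using MGB by (simp add: algebra_simps)
    then show ?thesis
      using Mpos by (simp add: ns_fraction_def G_def M_def pos_le_divide_eq)
  qed
  then show ?thesis
    unfolding eventually_sequentially
    by (intro exI[of _ "n1 + n2 + n3 + (2 * (K + K') + 1)"]) auto
qed

lemma ns_fraction_le_1: "ns_fraction n \<le> 1"
proof -
  have "card {D \<in> marked_diagrams n. north_south (diagram_map D)} \<le> card (marked_diagrams n)"
    by (rule card_mono[OF finite_marked_diagrams]) auto
  then show ?thesis by (auto simp: ns_fraction_def divide_le_eq_1)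
qed

theorem theorem1:
  shows "\<exists>L > 0. ns_fraction \<longlonglongrightarrow> L"
proof (intro exI conjI)
  show "ns_fraction \<longlonglongrightarrow> 1"
  proof (rule order_tendstoI)
    fix a :: real assume "a < 1"
    \<comment> \<open>The lower bound is the midpoint of \<open>a\<close> and \<open>1\<close>,
      hence strictly above \<open>a\<close>.\<close>
    then have "\<forall>\<^sub>F n in sequentially. 1 - 10 * ((1 - a) / 20) \<le> ns_fraction n"
      by (intro ns_fraction_ge) auto
    then show "\<forall>\<^sub>F n in sequentially. a < ns_fraction n"
      by (rule eventually_mono) (use \<open>a < 1\<close> in \<open>simp add: field_simps\<close>)
  next
    fix a :: real assume "1 < a"
    then show "\<forall>\<^sub>F n in sequentially. ns_fraction n < a"
      by (intro always_eventually allI le_less_trans[OF ns_fraction_le_1])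
  qed
qed simp

end
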